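(* Let $\varrho_n\to0$ with $n\varrho_n^{1/(2s)}\to\infty$. If $X_1,\dots,X_n$ are i.i.d. from $P_0$, then $$v_n^{-1/2}\big[n\,\eta^2_{\varrho_n}(\widehat P_n,P_0)-A_n\big]\xrightarrow{d}N(0,2),$$ where $v_n=\sum_{k\ge1}\big(\frac{\lambda_k}{\lambda_k+\varrho_n^2}\big)^2$ and $A_n=\frac1n\sum_{i=1}^n\tilde K_{\varrho_n}(X_i,X_i)$.
   Context: Standing setup. $(\mathcal X,\mathcal B)$ is a measurable space and $P_0$ a known probability measure on it. $K$ is a symmetric, positive semidefinite, square-integrable kernel, degenerate under $P_0$ ($\mathbb E_{P_0}K(X,\cdot)=0$), with Mercer decomposition $K(x,x')=\sum_{k\ge1}\lambda_k\varphi_k(x)\varphi_k(x')$, infinitely many eigenvalues $\lambda_1>\lambda_2>\cdots>0$, $\{\varphi_k\}$ an orthonormal basis of the $P_0$-mean-zero functions in $L_2(P_0)$, $0<\liminf_k k^{2s}\lambda_k\le\limsup_k k^{2s}\lambda_k<\infty$ for some $s>1/2$, and $\sup_k\|\varphi_k\|_\infty<\infty$. For $\varrho>0$, $\tilde K_\varrho(x,x')=\sum_{k\ge1}\frac{\lambda_k}{\lambda_k+\varrho^2}\varphi_k(x)\varphi_k(x')$, and the moderated MMD statistic is $\eta^2_{\varrho}(\widehat P_n,P_0)=\sum_{k\ge1}\frac{\lambda_k}{\lambda_k+\varrho^2}\big[\frac1n\sum_{i=1}^n\varphi_k(X_i)\big]^2$, where $\widehat P_n$ is the empirical distribution of $X_1,\dots,X_n$.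 *)

theory Defs
  imports "HOL-Probability.Probability"
begin

text \<open>Indexing convention: the paper's eigenpairs (lambda_k, phi_k), k = 1, 2, ...,
  are represented 0-based: lam k, phi k for k = 0, 1, ... stand for lambda_(k+1), phi_(k+1).\<close>

definition shrink :: "(nat \<Rightarrow> real) \<Rightarrow> real \<Rightarrow> nat \<Rightarrow> real" where
  "shrink lam r k = lam k / (lam k + r\<^sup>2)"

definition Ktilde :: "(nat \<Rightarrow> real) \<Rightarrow> (nat \<Rightarrow> 'a \<Rightarrow> real) \<Rightarrow> real \<Rightarrow> 'a \<Rightarrow> 'a \<Rightarrow> real" where
  "Ktilde lam phi r x x' = (\<Sum>k. shrink lam r k * phi k x * phi k x')"

definition eta2 :: "(nat \<Rightarrow> real) \<Rightarrow> (nat \<Rightarrow> 'a \<Rightarrow> real) \<Rightarrow> real \<Rightarrow> nat \<Rightarrow> (nat \<Rightarrow> 'a) \<Rightarrow> real" where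
  "eta2 lam phi r n xs = (\<Sum>k. shrink lam r k * ((1 / real n) * (\<Sum>i<n. phi k (xs i)))\<^sup>2)"

definition vn :: "(nat \<Rightarrow> real) \<Rightarrow> real \<Rightarrow> real" where
  "vn lam r = (\<Sum>k. (shrink lam r k)\<^sup>2)"

definition An :: "(nat \<Rightarrow> real) \<Rightarrow> (nat \<Rightarrow> 'a \<Rightarrow> real) \<Rightarrow> real \<Rightarrow> nat \<Rightarrow> (nat \<Rightarrow> 'a) \<Rightarrow> real" where
  "An lam phi r n xs = (1 / real n) * (\<Sum>i<n. Ktilde lam phi r (xs i) (xs i))"

end

theory Submission
  imports Defs
begin

text \<open>
  Up to the factor \<open>2/n\<close>, the centred statistic is the degenerate U-statistic
  \<open>\<Sum>\<^bsub>i<j\<^esub> H(X\<^sub>i, X\<^sub>j)\<close> with \<open>H = \<Sum>\<^sub>k a\<^sub>k \<phi>\<^sub>k \<otimes> \<phi>\<^sub>k\<close> and \<open>a\<^sub>k = \<lambda>\<^sub>k / (\<lambda>\<^sub>k + \<rho>\<^sup>2)\<close>. Summed over \<open>j\<close> it is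
  a martingale whose increment \<open>D\<^sub>j\<close>, rescaled by \<open>2 / (n \<surd>v)\<close>, has variance \<open>4 j / n\<^sup>2\<close>.
  Replacing the factors \<open>exp (i t D\<^sub>j)\<close> of the characteristic function one at a time by
  \<open>exp (- 2 t\<^sup>2 j / n\<^sup>2)\<close> costs the conditional third moment of \<open>D\<^sub>j\<close> and the \<open>L\<^sup>1\<close>-deviation of
  its conditional variance from its mean. Because the \<open>\<phi>\<^sub>k\<close> are uniformly bounded, every single
  conditional variance deviates by only \<open>O(1 / (n \<surd>v) + n\<^bsup>-3/2\<^esup>)\<close>, so no stopping argument is
  needed, and the total cost is of the order of the square root of \<open>1/n + S\<^sup>2/(n\<^sup>2 v) + 1/v\<close>
  with \<open>S = \<Sum>\<^sub>k a\<^sub>k\<close>. Both \<open>S\<close> and \<open>v\<close> are of order \<open>\<rho>\<^bsup>-1/s\<^esup>\<close>, which makes the middle term of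
  order \<open>(n \<rho>\<^bsup>1/(2s)\<^esup>)\<^bsup>-2\<^esup>\<close>. Levy's continuity theorem concludes.
\<close>

subsection \<open>Bounded measurable functions\<close>

text \<open>Bounded everywhere on the space rather than almost everywhere, a notion that survives
  composition with arbitrary measurable maps. Integrability and Fubini conditions thereby reduce
  mostly to closure rules.\<close>

definition bdd_measurable :: "'a measure \<Rightarrow> ('a \<Rightarrow> 'b::real_normed_field) \<Rightarrow> bool" where
  "bdd_measurable M f \<longleftrightarrow> f \<in> borel_measurable M \<and> (\<exists>C. \<forall>x\<in>space M. norm (f x) \<le> C)"

lemma bdd_measurableI:
  "f \<in> borel_measurable M \<Longrightarrow> (\<And>x. x \<in> space M \<Longrightarrow> norm (f x) \<le> C) \<Longrightarrow> bdd_measurable M f"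
  unfolding bdd_measurable_def by blast

lemma bdd_measurable_measurable: "bdd_measurable M f \<Longrightarrow> f \<in> borel_measurable M"
  unfolding bdd_measurable_def by blast

lemma bdd_measurableE:
  assumes "bdd_measurable M f"
  obtains C where "\<And>x. x \<in> space M \<Longrightarrow> norm (f x) \<le> C" "C \<ge> 0"
proof -
  obtain C where "\<forall>x\<in>space M. norm (f x) \<le> C" using assms unfolding bdd_measurable_def by blast
  then show ?thesis by (intro that[of "max C 0"]) (auto simp: le_max_iff_disj)
qed

lemma bdd_measurable_const: "bdd_measurable M (\<lambda>x. c)"
  by (rule bdd_measurableI[of _ _ "norm c"]) auto

lemma bdd_measurable_add:
  fixes f g :: "'a \<Rightarrow> 'b::{real_normed_field, second_countable_topology}"
  assumes "bdd_measurable M f" "bdd_measurable M g"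
  shows "bdd_measurable M (\<lambda>x. f x + g x)"
proof -
  obtain C D where "\<And>x. x \<in> space M \<Longrightarrow> norm (f x) \<le> C" "\<And>x. x \<in> space M \<Longrightarrow> norm (g x) \<le> D"
    using assms by (metis bdd_measurableE)
  then show ?thesis
    using assms[THEN bdd_measurable_measurable]
    by (intro bdd_measurableI[of _ _ "C + D"]) (auto intro: norm_triangle_mono)
qed

lemma bdd_measurable_mult:
  fixes f g :: "'a \<Rightarrow> 'b::{real_normed_field, second_countable_topology}"
  assumes "bdd_measurable M f" "bdd_measurable M g"
  shows "bdd_measurable M (\<lambda>x. f x * g x)"
proof -
  obtain C where C: "\<And>x. x \<in> space M \<Longrightarrow> norm (f x) \<le> C" "C \<ge> 0"
    using assms by (metis bdd_measurableE)
  obtain D where D: "\<And>x. x \<in> space M \<Longrightarrow> norm (g x) \<le> D" "D \<ge> 0"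
    using assms by (metis bdd_measurableE)
  show ?thesis
    using assms[THEN bdd_measurable_measurable] C D
    by (intro bdd_measurableI[of _ _ "C * D"]) (auto simp: norm_mult intro!: mult_mono)
qed

lemma bdd_measurable_diff:
  fixes f g :: "'a \<Rightarrow> 'b::{real_normed_field, second_countable_topology}"
  assumes "bdd_measurable M f" "bdd_measurable M g"
  shows "bdd_measurable M (\<lambda>x. f x - g x)"
  using bdd_measurable_add[OF assms(1) bdd_measurable_mult[OF bdd_measurable_const[of _ "-1"] assms(2)]]
  by simp

lemma bdd_measurable_divide_const:
  fixes f :: "'a \<Rightarrow> 'b::{real_normed_field, second_countable_topology}"
  assumes "bdd_measurable M f"
  shows "bdd_measurable M (\<lambda>x. f x / c)"
  using bdd_measurable_mult[OF assms bdd_measurable_const[of _ "inverse c"]]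
  by (simp add: divide_inverse)

lemma bdd_measurable_power:
  fixes f :: "'a \<Rightarrow> 'b::{real_normed_field, second_countable_topology}"
  assumes "bdd_measurable M f"
  shows "bdd_measurable M (\<lambda>x. f x ^ n)"
  using assms by (induction n) (auto intro: bdd_measurable_const bdd_measurable_mult)

lemma bdd_measurable_sum:
  fixes f :: "'i \<Rightarrow> 'a \<Rightarrow> 'b::{real_normed_field, second_countable_topology}"
  assumes "\<And>i. i \<in> I \<Longrightarrow> bdd_measurable M (f i)"
  shows "bdd_measurable M (\<lambda>x. \<Sum>i\<in>I. f i x)"
  using assms by (induction I rule: infinite_finite_induct) (auto intro: bdd_measurable_const bdd_measurable_add)

lemma bdd_measurable_of_real:
  "bdd_measurable M f \<Longrightarrow> bdd_measurable M (\<lambda>x. complex_of_real (f x))"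
  unfolding bdd_measurable_def by auto

lemma bdd_measurable_iexp:
  "bdd_measurable M f \<Longrightarrow> bdd_measurable M (\<lambda>x. iexp (f x))"
  by (rule bdd_measurableI[of _ _ 1]) (auto dest!: bdd_measurable_measurable)

lemmas bdd_measurable_intros = bdd_measurable_const bdd_measurable_add bdd_measurable_mult
  bdd_measurable_diff bdd_measurable_divide_const bdd_measurable_power bdd_measurable_sum
  bdd_measurable_of_real bdd_measurable_iexp

lemma bdd_measurable_compose:
  "bdd_measurable N f \<Longrightarrow> g \<in> measurable M N \<Longrightarrow> bdd_measurable M (\<lambda>x. f (g x))"
  unfolding bdd_measurable_def by (auto dest: measurable_space)

lemma (in finite_measure) integrable_bdd_measurable:
  fixes f :: "'a \<Rightarrow> 'b::{real_normed_field, banach, second_countable_topology}"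
  shows "bdd_measurable M f \<Longrightarrow> integrable M f"
  unfolding bdd_measurable_def by (auto intro: integrable_const_bound)

text \<open>The bound survives because \<open>N\<close> has total mass one. This keeps conditional
  expectations, written as partial integrals, inside the class.\<close>

lemma bdd_measurable_lebesgue_integral:
  fixes f :: "'a \<Rightarrow> 'b \<Rightarrow> 'c::{real_normed_field, banach, second_countable_topology}"
  assumes N: "prob_space N" and f: "bdd_measurable (M \<Otimes>\<^sub>M N) (\<lambda>(x, y). f x y)"
  shows "bdd_measurable M (\<lambda>x. \<integral>y. f x y \<partial>N)"
proof -
  interpret N: prob_space N by fact
  obtain C where C: "\<And>z. z \<in> space (M \<Otimes>\<^sub>M N) \<Longrightarrow> norm (case_prod f z) \<le> C"
    using f by (metis (mono_tags, lifting) bdd_measurableE)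
  have [measurable]: "(\<lambda>(x, y). f x y) \<in> borel_measurable (M \<Otimes>\<^sub>M N)"
    using f by (rule bdd_measurable_measurable)
  show ?thesis
  proof (rule bdd_measurableI)
    show "(\<lambda>x. \<integral>y. f x y \<partial>N) \<in> borel_measurable M" by measurable
    fix x assume x: "x \<in> space M"
    have "norm (f x y) \<le> C" if "y \<in> space N" for y
      using C[of "(x, y)"] x that by (simp add: space_pair_measure)
    moreover have "integrable N (f x)"
      using calculation x by (intro N.integrable_const_bound[of _ C]) auto
    ultimately have "(\<integral>y. norm (f x y) \<partial>N) \<le> (\<integral>y. C \<partial>N)"
      by (intro integral_mono) auto
    with integral_norm_bound[of N "f x"] have "norm (\<integral>y. f x y \<partial>N) \<le> (\<integral>y. C \<partial>N)"
      by linarith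
    then show "norm (\<integral>y. f x y \<partial>N) \<le> C" by (simp add: N.prob_space)
  qed
qed

subsection \<open>Moments of sums of i.i.d. variables\<close>

locale iid_seq = prob_space M + N: prob_space N
  for M :: "'b measure" and N :: "'a measure" +
  fixes X :: "nat \<Rightarrow> 'b \<Rightarrow> 'a"
  assumes X_measurable [measurable]: "\<And>i. X i \<in> measurable M N"
    and X_distr: "\<And>i. distr M N (X i) = N"
    and X_indep: "indep_vars (\<lambda>_. N) X UNIV"
begin

lemma integral_X:
  fixes f :: "'a \<Rightarrow> 'c::{banach, second_countable_topology}"
  assumes "f \<in> borel_measurable N"
  shows "(\<integral>\<omega>. f (X i \<omega>) \<partial>M) = (\<integral>x. f x \<partial>N)"
  using integral_distr[OF X_measurable assms, of i] by (simp add: X_distr)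

text \<open>The block of the first \<open>j\<close> observations is independent of
  \<open>X j\<close>, so the joint law is a product and Fubini applies in either order. The first
  form conditions on the past; the second freezes the newest observation and averages over the past.
  \<open>dep\<close> says that \<open>F\<close> reads only coordinates below \<open>j\<close>, which
  makes the restriction to the block harmless.\<close>

lemma
  fixes F :: "(nat \<Rightarrow> 'a) \<Rightarrow> 'a \<Rightarrow> 'c::{real_normed_field, banach, second_countable_topology}"
  assumes F: "bdd_measurable (PiM {..<j} (\<lambda>_. N) \<Otimes>\<^sub>M N) (\<lambda>(y, x). F y x)"
    and dep: "\<And>y x. F (\<lambda>i\<in>{..<j}. y i) x = F y x"
  shows integrate_last: "(\<integral>\<omega>. F (\<lambda>i. X i \<omega>) (X j \<omega>) \<partial>M) = (\<integral>\<omega>. (\<integral>x. F (\<lambda>i. X i \<omega>) x \<partial>N) \<partial>M)"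
    and integrate_last': "(\<integral>\<omega>. F (\<lambda>i. X i \<omega>) (X j \<omega>) \<partial>M) = (\<integral>x. (\<integral>\<omega>. F (\<lambda>i. X i \<omega>) x \<partial>M) \<partial>N)"
proof -
  let ?W = "\<lambda>\<omega>. \<lambda>i\<in>{..<j}. X i \<omega>" and ?P = "PiM {..<j} (\<lambda>_. N)"
  have W [measurable]: "?W \<in> measurable M ?P" by (intro measurable_restrict) auto
  note F_meas [measurable] = bdd_measurable_measurable[OF F]
  \<comment> \<open>\<open>indep_var_restrict\<close> speaks of blocks of coordinates, so the single
    variable \<open>X j\<close> is carried as a block indexed by \<open>{j}\<close> and read off by
    evaluation at \<open>j\<close>.\<close>
  let ?J = "PiM {j} (\<lambda>_. N)" and ?V = "\<lambda>\<omega>. \<lambda>i\<in>{j}. X i \<omega>"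
  have V [measurable]: "?V \<in> measurable M ?J" by (intro measurable_restrict) auto
  have ind: "indep_var ?P ?W ?J ?V"
    by (intro indep_var_restrict[OF X_indep]) auto
  define Q R where "Q = distr M ?P ?W" and "R = distr M ?J ?V"
  have sQ [measurable_cong]: "sets Q = sets ?P" and sR [measurable_cong]: "sets R = sets ?J"
    by (simp_all add: Q_def R_def)
  interpret Q: prob_space Q unfolding Q_def by (intro prob_space_distr) measurable
  interpret R: prob_space R unfolding R_def by (intro prob_space_distr) measurable
  interpret QR: pair_prob_space Q R ..
  have joint: "Q \<Otimes>\<^sub>M R = distr M (?P \<Otimes>\<^sub>M ?J) (\<lambda>\<omega>. (?W \<omega>, ?V \<omega>))"
    using ind unfolding indep_var_distribution_eq Q_def R_def by blast
  have coord: "(\<lambda>r. r j) \<in> measurable R N"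
    unfolding measurable_cong_sets[OF sR refl] by (rule measurable_component_singleton) auto
  have "bdd_measurable (Q \<Otimes>\<^sub>M R) (\<lambda>z. (\<lambda>(y, x). F y x) (fst z, snd z j))"
    using coord by (intro bdd_measurable_compose[OF F] measurable_Pair) measurable
  then have int: "integrable (Q \<Otimes>\<^sub>M R) (\<lambda>(y, r). F y (r j))"
    using QR.integrable_bdd_measurable by (auto simp: case_prod_unfold)
  have int_R: "(\<integral>r. F y (r j) \<partial>R) = (\<integral>x. F y x \<partial>N)" if "y \<in> space ?P" for y
  proof -
    have [measurable]: "F y \<in> borel_measurable N" using that by measurable
    show ?thesis unfolding R_def by (subst integral_distr) (auto simp: integral_X)
  qed
  have int_Q: "(\<integral>y. F y x \<partial>Q) = (\<integral>\<omega>. F (\<lambda>i. X i \<omega>) x \<partial>M)" if "x \<in> space N" for x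
    using that unfolding Q_def by (subst integral_distr) (auto simp: dep)
  have "(\<integral>\<omega>. F (\<lambda>i. X i \<omega>) (X j \<omega>) \<partial>M) = (\<integral>\<omega>. (\<lambda>(y, r). F y (r j)) (?W \<omega>, ?V \<omega>) \<partial>M)"
    by (simp add: dep)
  also have "\<dots> = (\<integral>z. (\<lambda>(y, r). F y (r j)) z \<partial>(Q \<Otimes>\<^sub>M R))"
    unfolding joint by (subst integral_distr) auto
  finally have *: "(\<integral>\<omega>. F (\<lambda>i. X i \<omega>) (X j \<omega>) \<partial>M) = (\<integral>z. (\<lambda>(y, r). F y (r j)) z \<partial>(Q \<Otimes>\<^sub>M R))" .
  have "\<dots> = (\<integral>y. (\<integral>r. F y (r j) \<partial>R) \<partial>Q)"
    by (simp add: QR.integral_fst'[OF int, symmetric])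
  also have "\<dots> = (\<integral>y. (\<integral>x. F y x \<partial>N) \<partial>Q)"
    by (intro Bochner_Integration.integral_cong refl int_R) (simp add: sets_eq_imp_space_eq[OF sQ])
  also have "\<dots> = (\<integral>\<omega>. (\<integral>x. F (?W \<omega>) x \<partial>N) \<partial>M)"
    unfolding Q_def by (subst integral_distr) auto
  finally show "(\<integral>\<omega>. F (\<lambda>i. X i \<omega>) (X j \<omega>) \<partial>M) = (\<integral>\<omega>. (\<integral>x. F (\<lambda>i. X i \<omega>) x \<partial>N) \<partial>M)"
    using * by (simp add: dep)
  have "(\<integral>z. (\<lambda>(y, r). F y (r j)) z \<partial>(Q \<Otimes>\<^sub>M R)) = (\<integral>r. (\<integral>y. F y (r j) \<partial>Q) \<partial>R)"
    using QR.integral_snd[OF int] by simp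
  also have "\<dots> = (\<integral>\<omega>. (\<integral>y. F y (?V \<omega> j) \<partial>Q) \<partial>M)"
    unfolding R_def by (subst integral_distr) auto
  also have "\<dots> = (\<integral>x. (\<integral>y. F y x \<partial>Q) \<partial>N)"
    by (simp add: integral_X[of "\<lambda>x. \<integral>y. F y x \<partial>Q"])
  also have "\<dots> = (\<integral>x. (\<integral>\<omega>. F (\<lambda>i. X i \<omega>) x \<partial>M) \<partial>N)"
    by (intro Bochner_Integration.integral_cong refl int_Q)
  finally show "(\<integral>\<omega>. F (\<lambda>i. X i \<omega>) (X j \<omega>) \<partial>M) = (\<integral>x. (\<integral>\<omega>. F (\<lambda>i. X i \<omega>) x \<partial>M) \<partial>N)"
    using * by simp
qed

end

section \<open>Auxiliary estimates for a single increment\<close>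

lemma bdd_measurable_compose2:
  assumes "bdd_measurable (N \<Otimes>\<^sub>M N) (\<lambda>(x, y). g x y)" "u \<in> measurable L N" "v \<in> measurable L N"
  shows "bdd_measurable L (\<lambda>z. g (u z) (v z))"
  using bdd_measurable_compose[OF assms(1) measurable_Pair[OF assms(2,3)]] by simp

text \<open>Weighted AM-GM. It trades the third absolute moment for the second and fourth ones,
  which can be computed by expansion; the weight \<open>d\<close> stays free for later
  balancing.\<close>

lemma abs_power3_le:
  fixes d x :: real
  assumes "d > 0"
  shows "\<bar>x\<bar> ^ 3 \<le> (d * x\<^sup>2 + x ^ 4 / d) / 2"
proof -
  have "0 \<le> x\<^sup>2 * (d - \<bar>x\<bar>)\<^sup>2" by simp
  also have "\<dots> = d * (d * x\<^sup>2) + x ^ 4 - 2 * d * \<bar>x\<bar> ^ 3"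
    by (simp add: power2_eq_square power3_eq_cube power4_eq_xxxx algebra_simps)
  finally show ?thesis using assms by (simp add: field_simps)
qed

text \<open>Takes the place of Cauchy-Schwarz in bounding an L1-deviation by a variance: with a free
  weight the bound is linear in the square and can be integrated directly.\<close>

lemma abs_le_square:
  fixes d x :: real
  assumes "d > 0"
  shows "\<bar>x\<bar> \<le> (d + x\<^sup>2 / d) / 2"
proof -
  have "0 \<le> (d - \<bar>x\<bar>)\<^sup>2" by simp
  also have "\<dots> = d * d + x\<^sup>2 - 2 * d * \<bar>x\<bar>"
    by (simp add: power2_diff) (simp add: power2_eq_square)
  finally have "\<bar>x\<bar> \<le> (d * d + x\<^sup>2) / (2 * d)"
    using assms by (simp add: pos_le_divide_eq mult.commute)
  also have "\<dots> = (d + x\<^sup>2 / d) / 2"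
    using assms by (simp add: add_divide_distrib)
  finally show ?thesis .
qed

lemma exp_minus_approx:
  fixes u :: real
  assumes "u \<ge> 0"
  shows "\<bar>exp (- u) - (1 - u)\<bar> \<le> u\<^sup>2 / 2"
proof -
  have "exp (- u) \<ge> 1 - u" using exp_ge_add_one_self[of "-u"] by simp
  moreover have "exp (- u) \<le> 1 - u + u\<^sup>2 / 2"
  proof -
    \<comment> \<open>\<open>h\<close> vanishes at 0 and its derivative
      \<open>exp (- x) - (1 - x)\<close> is nonnegative by the tangent inequality.\<close>
    define h where "h x = 1 - x + x\<^sup>2 / 2 - exp (- x)" for x :: real
    have "(h has_real_derivative (- 1 + x + exp (- x))) (at x)" for x
      unfolding h_def by (auto intro!: derivative_eq_intros)
    moreover have "- 1 + x + exp (- x) \<ge> 0" for x :: real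
      using exp_ge_add_one_self[of "-x"] by simp
    ultimately have "h 0 \<le> h u"
      by (intro DERIV_nonneg_imp_nondecreasing[OF assms] exI conjI)
    then show ?thesis by (simp add: h_def)
  qed
  ultimately show ?thesis by simp
qed

text \<open>Both exponentials are compared with Taylor polynomials, and the zero mean removes the
  linear term. The three errors are the cubic remainder, the mismatch between the variance of
  \<open>D\<close> and the target variance \<open>c\<close>, and the remainder of the real
  exponential.\<close>

lemma (in prob_space) char_approx_normal:
  assumes D: "bdd_measurable M D" and mean: "expectation D = 0" and "d > 0" "c \<ge> 0"
  shows "cmod ((CLINT x|M. iexp (t * D x)) - exp (- (t\<^sup>2 * c / 2)))
    \<le> \<bar>t\<bar> ^ 3 / 12 * (d * expectation (\<lambda>x. (D x)\<^sup>2) + expectation (\<lambda>x. D x ^ 4) / d)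
      + t\<^sup>2 / 2 * \<bar>expectation (\<lambda>x. (D x)\<^sup>2) - c\<bar> + t ^ 4 * c\<^sup>2 / 8"
proof -
  define P where "P x = 1 + \<i> * of_real (t * D x) - of_real ((t * D x)\<^sup>2 / 2)" for x
  note int = integrable_bdd_measurable bdd_measurable_intros D
  have iP: "integrable M P" unfolding P_def by (intro int)
  have iI: "integrable M (\<lambda>x. iexp (t * D x))" by (intro int)
  have EP: "(CLINT x|M. P x) = of_real (1 - t\<^sup>2 / 2 * expectation (\<lambda>x. (D x)\<^sup>2))"
  proof -
    have "(CLINT x|M. P x) = (CLINT x|M. 1) + \<i> * (CLINT x|M. of_real (t * D x))
        - (CLINT x|M. of_real ((t * D x)\<^sup>2 / 2))"
    proof -
      have "integrable M (\<lambda>x. 1 + \<i> * of_real (t * D x))"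
        "integrable M (\<lambda>x. \<i> * complex_of_real (t * D x))"
        "integrable M (\<lambda>x. complex_of_real ((t * D x)\<^sup>2 / 2))"
        by (intro int)+
      then show ?thesis
        unfolding P_def by (simp del: of_real_mult of_real_power of_real_divide)
    qed
    also have "(CLINT x|M. of_real (t * D x)) = 0"
      by (simp add: integral_complex_of_real mean del: of_real_mult)
    also have "(CLINT x|M. of_real ((t * D x)\<^sup>2 / 2)) = of_real (t\<^sup>2 / 2 * expectation (\<lambda>x. (D x)\<^sup>2))"
      by (simp add: integral_complex_of_real power_mult_distrib del: of_real_mult of_real_power of_real_divide)
    finally show ?thesis by (simp add: prob_space)
  qed
  have pt: "cmod (iexp u - (1 + \<i> * of_real u - of_real (u\<^sup>2 / 2))) \<le> \<bar>u\<bar> ^ 3 / 6" for u :: real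
    using iexp_approx1[of u 2]
    by (simp add: atMost_Suc numeral_2_eq_2 fact_numeral eval_nat_numeral algebra_simps)
  have "cmod ((CLINT x|M. iexp (t * D x)) - (CLINT x|M. P x))
      = cmod (CLINT x|M. iexp (t * D x) - P x)"
    by (simp only: Bochner_Integration.integral_diff[OF iI iP])
  also have "\<dots> \<le> expectation (\<lambda>x. cmod (iexp (t * D x) - P x))"
    by (rule integral_norm_bound)
  also have "\<dots> \<le> expectation (\<lambda>x. \<bar>t\<bar> ^ 3 / 12 * (d * (D x)\<^sup>2 + D x ^ 4 / d))"
  proof (rule integral_mono)
    show "integrable M (\<lambda>x. cmod (iexp (t * D x) - P x))"
      using iI iP by auto
    show "integrable M (\<lambda>x. \<bar>t\<bar> ^ 3 / 12 * (d * (D x)\<^sup>2 + D x ^ 4 / d))"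
      by (intro int)
    fix x
    have "cmod (iexp (t * D x) - P x) \<le> \<bar>t\<bar> ^ 3 / 6 * \<bar>D x\<bar> ^ 3"
      using pt[of "t * D x"] by (simp add: P_def abs_mult power_mult_distrib)
    also have "\<dots> \<le> \<bar>t\<bar> ^ 3 / 6 * ((d * (D x)\<^sup>2 + D x ^ 4 / d) / 2)"
      by (intro mult_left_mono abs_power3_le \<open>d > 0\<close>) auto
    finally show "cmod (iexp (t * D x) - P x) \<le> \<bar>t\<bar> ^ 3 / 12 * (d * (D x)\<^sup>2 + D x ^ 4 / d)"
      by simp
  qed
  also have "\<dots> = \<bar>t\<bar> ^ 3 / 12 * (d * expectation (\<lambda>x. (D x)\<^sup>2) + expectation (\<lambda>x. D x ^ 4) / d)"
  proof -
    have "integrable M (\<lambda>x. d * (D x)\<^sup>2)" "integrable M (\<lambda>x. D x ^ 4 / d)" by (intro int)+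
    then show ?thesis by simp
  qed
  finally have 1: "cmod ((CLINT x|M. iexp (t * D x)) - (CLINT x|M. P x)) \<le> \<dots>" .
  have "(CLINT x|M. P x) - exp (- (t\<^sup>2 * c / 2))
      = of_real (- (t\<^sup>2 / 2) * (expectation (\<lambda>x. (D x)\<^sup>2) - c) - (exp (- (t\<^sup>2 * c / 2)) - (1 - t\<^sup>2 * c / 2)))"
    unfolding EP by (simp add: algebra_simps)
  then have "cmod ((CLINT x|M. P x) - exp (- (t\<^sup>2 * c / 2)))
      = \<bar>- (t\<^sup>2 / 2) * (expectation (\<lambda>x. (D x)\<^sup>2) - c) - (exp (- (t\<^sup>2 * c / 2)) - (1 - t\<^sup>2 * c / 2))\<bar>"
    by (simp only: norm_of_real)
  also have "\<dots> \<le> \<bar>- (t\<^sup>2 / 2) * (expectation (\<lambda>x. (D x)\<^sup>2) - c)\<bar> + \<bar>exp (- (t\<^sup>2 * c / 2)) - (1 - t\<^sup>2 * c / 2)\<bar>"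
    by linarith
  also have "\<dots> \<le> t\<^sup>2 / 2 * \<bar>expectation (\<lambda>x. (D x)\<^sup>2) - c\<bar> + (t\<^sup>2 * c / 2)\<^sup>2 / 2"
    using \<open>c \<ge> 0\<close> by (intro add_mono exp_minus_approx) (auto simp: abs_mult)
  also have "(t\<^sup>2 * c / 2)\<^sup>2 / 2 = t ^ 4 * c\<^sup>2 / 8"
    by (simp add: power2_eq_square power4_eq_xxxx)
  finally have 2: "cmod ((CLINT x|M. P x) - exp (- (t\<^sup>2 * c / 2))) \<le>
     t\<^sup>2 / 2 * \<bar>expectation (\<lambda>x. (D x)\<^sup>2) - c\<bar> + t ^ 4 * c\<^sup>2 / 8" .
  let ?a = "CLINT x|M. iexp (t * D x)" and ?b = "CLINT x|M. P x"
  have "?a - exp (- (t\<^sup>2 * c / 2)) = (?a - ?b) + (?b - exp (- (t\<^sup>2 * c / 2)))" by simp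
  then show ?thesis
    using 1 2 norm_triangle_mono[OF 1 2] by (simp only: add.assoc)
qed

text \<open>Binomial expansion, with the term linear in \<open>f\<close> killed by the zero mean. In
  the inductions below \<open>s\<close> is the contribution of the past, a constant while only the
  newest observation is integrated.\<close>

lemma (in prob_space)
  fixes f :: "'a \<Rightarrow> real"
  assumes f: "bdd_measurable M f" and mean: "expectation f = 0"
  shows expectation_shift_power2: "expectation (\<lambda>x. (s + f x)\<^sup>2) = s\<^sup>2 + expectation (\<lambda>x. (f x)\<^sup>2)"
    and expectation_shift_power4: "expectation (\<lambda>x. (s + f x) ^ 4) =
      s ^ 4 + 6 * s\<^sup>2 * expectation (\<lambda>x. (f x)\<^sup>2) + 4 * s * expectation (\<lambda>x. f x ^ 3)
      + expectation (\<lambda>x. f x ^ 4)"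
proof -
  have i: "integrable M (\<lambda>x. f x ^ k)" for k by (intro integrable_bdd_measurable bdd_measurable_intros f)
  have i1: "integrable M f" by (intro integrable_bdd_measurable bdd_measurable_intros f)
  have "(\<lambda>x. (s + f x)\<^sup>2) = (\<lambda>x. s\<^sup>2 + (2 * s) * f x + (f x)\<^sup>2)"
    by (auto simp: power2_eq_square algebra_simps)
  then show "expectation (\<lambda>x. (s + f x)\<^sup>2) = s\<^sup>2 + expectation (\<lambda>x. (f x)\<^sup>2)"
    using i i1 by (simp add: mean prob_space)
  have "(\<lambda>x. (s + f x) ^ 4) = (\<lambda>x. s ^ 4 + (4 * s ^ 3) * f x + (6 * s\<^sup>2) * (f x)\<^sup>2 + (4 * s) * f x ^ 3 + f x ^ 4)"
    by (auto simp: power2_eq_square power3_eq_cube power4_eq_xxxx algebra_simps)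
  then show "expectation (\<lambda>x. (s + f x) ^ 4) =
      s ^ 4 + 6 * s\<^sup>2 * expectation (\<lambda>x. (f x)\<^sup>2) + 4 * s * expectation (\<lambda>x. f x ^ 3)
      + expectation (\<lambda>x. f x ^ 4)"
    using i i1 by (simp add: mean prob_space)
qed

section \<open>Second and fourth moments of centred i.i.d. sums\<close>

context iid_seq
begin

lemma measurable_prev [measurable]:
  "i < j \<Longrightarrow> (\<lambda>z. fst z i) \<in> measurable (PiM {..<j} (\<lambda>_. N) \<Otimes>\<^sub>M N) N"
  by (intro measurable_compose[OF measurable_fst measurable_component_singleton]) auto

lemma bdd_measurable_X: "bdd_measurable N f \<Longrightarrow> bdd_measurable M (\<lambda>\<omega>. f (X i \<omega>))"
  by (rule bdd_measurable_compose) auto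

text \<open>Induction on the number of summands, integrating out the last one. In the fourth power
  the term with the third moment of \<open>f\<close> drops out because the partial sum has mean
  zero; the mixed quadratic term produces the Gaussian leading constant 3.\<close>

lemma
  fixes f :: "'a \<Rightarrow> real"
  assumes f: "bdd_measurable N f" and mean: "N.expectation f = 0"
  shows expectation_sum_power2:
      "expectation (\<lambda>\<omega>. (\<Sum>i<j. f (X i \<omega>))\<^sup>2) = real j * N.expectation (\<lambda>x. (f x)\<^sup>2)"
    and expectation_sum_power4: "expectation (\<lambda>\<omega>. (\<Sum>i<j. f (X i \<omega>)) ^ 4)
      \<le> 3 * (real j)\<^sup>2 * (N.expectation (\<lambda>x. (f x)\<^sup>2))\<^sup>2 + real j * N.expectation (\<lambda>x. f x ^ 4)"
proof -
  note fm = bdd_measurable_measurable[OF f]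
  have int: "integrable M (\<lambda>\<omega>. (\<Sum>i<j. f (X i \<omega>)) ^ k)" for j k
    by (intro integrable_bdd_measurable bdd_measurable_power bdd_measurable_sum bdd_measurable_X f)
  note int1 = int[of _ 1, simplified]
  have E1: "expectation (\<lambda>\<omega>. \<Sum>i<j. f (X i \<omega>)) = 0" for j
    by (subst Bochner_Integration.integral_sum)
       (auto intro!: integrable_bdd_measurable bdd_measurable_X f simp: integral_X[OF fm] mean)
  have step: "expectation (\<lambda>\<omega>. (\<Sum>i<Suc j. f (X i \<omega>)) ^ p)
     = expectation (\<lambda>\<omega>. N.expectation (\<lambda>x. ((\<Sum>i<j. f (X i \<omega>)) + f x) ^ p))" for j p
    unfolding sum.lessThan_Suc
    by (rule integrate_last[where F = "\<lambda>y x. ((\<Sum>i<j. f (y i)) + f x) ^ p"])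
       (auto simp: case_prod_beta' intro!: bdd_measurable_intros bdd_measurable_compose[OF f])
  have E2: "expectation (\<lambda>\<omega>. (\<Sum>i<j. f (X i \<omega>))\<^sup>2) = real j * N.expectation (\<lambda>x. (f x)\<^sup>2)" for j
  proof (induction j)
    case (Suc j)
    then show ?case unfolding step N.expectation_shift_power2[OF f mean]
      using int by (simp add: prob_space algebra_simps)
  qed simp
  show "expectation (\<lambda>\<omega>. (\<Sum>i<j. f (X i \<omega>))\<^sup>2) = real j * N.expectation (\<lambda>x. (f x)\<^sup>2)" by (rule E2)
  show "expectation (\<lambda>\<omega>. (\<Sum>i<j. f (X i \<omega>)) ^ 4)
      \<le> 3 * (real j)\<^sup>2 * (N.expectation (\<lambda>x. (f x)\<^sup>2))\<^sup>2 + real j * N.expectation (\<lambda>x. f x ^ 4)"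
  proof (induction j)
    case (Suc j)
    let ?m = "N.expectation (\<lambda>x. (f x)\<^sup>2)"
    have "expectation (\<lambda>\<omega>. (\<Sum>i<Suc j. f (X i \<omega>)) ^ 4) = expectation (\<lambda>\<omega>. (\<Sum>i<j. f (X i \<omega>)) ^ 4)
      + 6 * (real j * ?m) * ?m + N.expectation (\<lambda>x. f x ^ 4)"
      unfolding step N.expectation_shift_power4[OF f mean]
      using int int1 by (simp add: prob_space E1 E2)
    also have "\<dots> \<le> 3 * (real j)\<^sup>2 * ?m\<^sup>2 + real j * N.expectation (\<lambda>x. f x ^ 4)
      + 6 * (real j * ?m) * ?m + N.expectation (\<lambda>x. f x ^ 4)"
      using Suc by simp
    also have "\<dots> = (3 * (real j)\<^sup>2 + 6 * real j) * ?m\<^sup>2 + real (Suc j) * N.expectation (\<lambda>x. f x ^ 4)"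
      by (simp add: algebra_simps power2_eq_square)
    \<comment> \<open>The leading coefficient absorbs the mixed term because
      \<open>3 j^2 + 6 j \<le> 3 (j + 1)^2\<close>.\<close>
    also have "\<dots> \<le> (3 * (real (Suc j))\<^sup>2) * ?m\<^sup>2 + real (Suc j) * N.expectation (\<lambda>x. f x ^ 4)"
      by (intro add_mono mult_right_mono) (auto simp: power2_eq_square algebra_simps)
    finally show ?case .
  qed simp
qed

end

subsection \<open>Normal approximation of degenerate U-statistics\<close>

text \<open>\<open>G\<close> is the kernel of the square of the integral operator of \<open>g\<close>.\<close>

locale degenerate_kernel = iid_seq M N X
  for M :: "'b measure" and N :: "'a measure" and X :: "nat \<Rightarrow> 'b \<Rightarrow> 'a" +
  fixes g G :: "'a \<Rightarrow> 'a \<Rightarrow> real" and \<tau> \<beta> K w :: real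
  assumes g_bdd: "bdd_measurable (N \<Otimes>\<^sub>M N) (\<lambda>(x, y). g x y)"
    and g_sym: "\<And>x y. g x y = g y x"
    and g_le: "\<And>x y. x \<in> space N \<Longrightarrow> y \<in> space N \<Longrightarrow> \<bar>g x y\<bar> \<le> K"
    and g_mean: "\<And>y. y \<in> space N \<Longrightarrow> N.expectation (\<lambda>x. g x y) = 0"
    and G_bdd: "bdd_measurable (N \<Otimes>\<^sub>M N) (\<lambda>(x, y). G x y)"
    and G_sym: "\<And>x y. G x y = G y x"
    and G_le: "\<And>x y. x \<in> space N \<Longrightarrow> y \<in> space N \<Longrightarrow> \<bar>G x y\<bar> \<le> \<beta>"
    and G_mean: "\<And>y. y \<in> space N \<Longrightarrow> N.expectation (\<lambda>x. G x y) = 0"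
    and G_square: "\<And>y. y \<in> space N \<Longrightarrow> N.expectation (\<lambda>x. (G x y)\<^sup>2) \<le> w"
    and G_diag: "N.expectation (\<lambda>x. G x x) = \<tau>"
    and G_eq: "\<And>y y'. y \<in> space N \<Longrightarrow> y' \<in> space N \<Longrightarrow> N.expectation (\<lambda>x. g x y * g x y') = G y y'"
begin

lemma bdd_g1: "y \<in> space N \<Longrightarrow> bdd_measurable N (\<lambda>x. g x y)"
  and bdd_g2: "y \<in> space N \<Longrightarrow> bdd_measurable N (\<lambda>x. g y x)"
  and bdd_G1: "y \<in> space N \<Longrightarrow> bdd_measurable N (\<lambda>x. G x y)"
  and bdd_G2: "y \<in> space N \<Longrightarrow> bdd_measurable N (\<lambda>x. G y x)"
  and bdd_G_diag: "bdd_measurable N (\<lambda>x. G x x)"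
  by (auto intro!: bdd_measurable_compose2[OF g_bdd] bdd_measurable_compose2[OF G_bdd])

text \<open>By \<open>G_eq\<close> the diagonal value is the second moment of \<open>g\<close> with
  one argument frozen.\<close>

lemma G_diag_nonneg: "y \<in> space N \<Longrightarrow> 0 \<le> G y y"
  by (subst G_eq[symmetric]) (auto intro!: integral_nonneg_AE)

lemma tau_nonneg: "0 \<le> \<tau>"
  unfolding G_diag[symmetric] by (intro integral_nonneg_AE AE_I2 G_diag_nonneg)

lemma tau_le: "\<tau> \<le> \<beta>"
proof -
  have "N.expectation (\<lambda>x. G x x) \<le> N.expectation (\<lambda>x. \<beta>)"
    using G_le by (intro integral_mono N.integrable_bdd_measurable bdd_G_diag bdd_measurable_const)
      (auto simp: abs_le_iff)
  then show ?thesis by (simp add: G_diag N.prob_space)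
qed

lemma w_nonneg: "0 \<le> w"
proof -
  obtain y where "y \<in> space N" using N.not_empty by blast
  then have "N.expectation (\<lambda>x. (G x y)\<^sup>2) \<le> w" by (rule G_square)
  moreover have "0 \<le> N.expectation (\<lambda>x. (G x y)\<^sup>2)" by (intro integral_nonneg_AE) auto
  ultimately show ?thesis by linarith
qed

text \<open>Pairs are grouped by their larger index, so that each new observation contributes
  exactly one inner sum, the martingale increment.\<close>

definition U :: "nat \<Rightarrow> 'b \<Rightarrow> real" where
  "U n \<omega> = (\<Sum>j<n. \<Sum>i<j. g (X i \<omega>) (X j \<omega>))"

text \<open>The increments of \<open>U\<close> are martingale differences, and \<open>cond_var j\<close> is the conditional
  variance of the \<open>j\<close>-th one given the first \<open>j\<close> observations (see \<open>increment_square\<close>).\<close>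

definition cond_var :: "nat \<Rightarrow> (nat \<Rightarrow> 'a) \<Rightarrow> real" where
  "cond_var j y = (\<Sum>a<j. \<Sum>b<j. G (y a) (y b))"

section \<open>Moments of the increments and of their conditional variances\<close>

lemma X_space: "\<omega> \<in> space M \<Longrightarrow> X i \<omega> \<in> space N"
  by (rule measurable_space[OF X_measurable])

lemma bdd_g_X: "bdd_measurable M (\<lambda>\<omega>. g (X i \<omega>) (X j \<omega>))"
  and bdd_G_X: "bdd_measurable M (\<lambda>\<omega>. G (X i \<omega>) (X j \<omega>))"
  by (auto intro!: bdd_measurable_compose2[OF g_bdd] bdd_measurable_compose2[OF G_bdd])

lemma bdd_U: "bdd_measurable M (U n)"
  unfolding U_def by (intro bdd_measurable_intros bdd_g_X)

lemma bdd_cond_var: "bdd_measurable M (\<lambda>\<omega>. cond_var n (\<lambda>i. X i \<omega>))"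
  unfolding cond_var_def by (intro bdd_measurable_intros bdd_G_X)

text \<open>The martingale difference property: with the past frozen, degeneracy of \<open>g\<close>
  annihilates every term.\<close>

lemma increment_mean:
  assumes "\<And>i. i < j \<Longrightarrow> y i \<in> space N"
  shows "N.expectation (\<lambda>x. \<Sum>i<j. g (y i) x) = 0"
proof -
  have "N.expectation (\<lambda>x. g (y i) x) = 0" if "i < j" for i
    using g_mean[OF assms[OF that]] g_sym by simp
  then show ?thesis
    using assms by (subst Bochner_Integration.integral_sum)
      (auto intro!: N.integrable_bdd_measurable bdd_g2)
qed

lemma increment_square:
  assumes "\<And>i. i < j \<Longrightarrow> y i \<in> space N"
  shows "N.expectation (\<lambda>x. (\<Sum>i<j. g (y i) x)\<^sup>2) = cond_var j y"
proof -
  have "N.expectation (\<lambda>x. (\<Sum>i<j. g (y i) x)\<^sup>2)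
      = N.expectation (\<lambda>x. \<Sum>a<j. \<Sum>b<j. g x (y a) * g x (y b))"
    by (simp add: power2_eq_square sum_product g_sym)
  also have "\<dots> = (\<Sum>a<j. \<Sum>b<j. N.expectation (\<lambda>x. g x (y a) * g x (y b)))"
    using assms by (subst Bochner_Integration.integral_sum,
        auto intro!: N.integrable_bdd_measurable bdd_measurable_intros bdd_g1)
      (intro sum.cong refl Bochner_Integration.integral_sum,
        auto intro!: N.integrable_bdd_measurable bdd_measurable_intros bdd_g1)
  also have "\<dots> = cond_var j y"
    unfolding cond_var_def using assms by (intro sum.cong refl G_eq) auto
  finally show ?thesis .
qed

text \<open>Exchanging the order of integration freezes the newest point \<open>x\<close> and leaves
  a sum of centred i.i.d. variables \<open>g (X i) x\<close>. Their variance is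
  \<open>G x x\<close>, at most \<open>\<beta>\<close>, and their fourth moment at most
  \<open>K^2\<close> times that, so \<open>expectation_sum_power4\<close> applies.\<close>

lemma expectation_increment_power4:
  "expectation (\<lambda>\<omega>. N.expectation (\<lambda>x. (\<Sum>i<j. g (X i \<omega>) x) ^ 4))
    \<le> 3 * (real j)\<^sup>2 * \<beta>\<^sup>2 + real j * (K\<^sup>2 * \<beta>)"
proof -
  have bd: "bdd_measurable (PiM {..<j} (\<lambda>_. N) \<Otimes>\<^sub>M N) (\<lambda>(y, x). (\<Sum>i<j. g (y i) x) ^ 4)"
    by (auto simp: case_prod_beta' intro!: bdd_measurable_intros bdd_measurable_compose2[OF g_bdd])
  have "expectation (\<lambda>\<omega>. N.expectation (\<lambda>x. (\<Sum>i<j. g (X i \<omega>) x) ^ 4))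
      = N.expectation (\<lambda>x. expectation (\<lambda>\<omega>. (\<Sum>i<j. g (X i \<omega>) x) ^ 4))"
    \<comment> \<open>First back to the joint integral over past and newest observation, then out in
      the other order.\<close>
    by (subst integrate_last[OF bd, symmetric], simp, subst integrate_last'[OF bd]) auto
  also have "\<dots> \<le> N.expectation (\<lambda>x. 3 * (real j)\<^sup>2 * \<beta>\<^sup>2 + real j * (K\<^sup>2 * \<beta>))"
  proof (intro integral_mono N.integrable_bdd_measurable bdd_measurable_const)
    have "bdd_measurable (N \<Otimes>\<^sub>M M) (\<lambda>(x, \<omega>). (\<Sum>i<j. g (X i \<omega>) x) ^ 4)"
      by (auto simp: case_prod_beta' intro!: bdd_measurable_intros bdd_measurable_compose2[OF g_bdd])
    then show "bdd_measurable N (\<lambda>x. expectation (\<lambda>\<omega>. (\<Sum>i<j. g (X i \<omega>) x) ^ 4))"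
      by (rule bdd_measurable_lebesgue_integral[OF prob_space_axioms])
    fix x assume x: "x \<in> space N"
    have m2: "N.expectation (\<lambda>y. (g y x)\<^sup>2) = G x x"
      using G_eq[OF x x] by (simp add: power2_eq_square)
    have "N.expectation (\<lambda>y. (g y x) ^ 4) \<le> N.expectation (\<lambda>y. K\<^sup>2 * (g y x)\<^sup>2)"
    proof (intro integral_mono N.integrable_bdd_measurable bdd_measurable_intros bdd_g1 x)
      fix y assume y: "y \<in> space N"
      have "(g y x)\<^sup>2 \<le> K\<^sup>2"
        using power_mono[OF g_le[OF y x], of 2] by simp
      then have "(g y x)\<^sup>2 * (g y x)\<^sup>2 \<le> K\<^sup>2 * (g y x)\<^sup>2" by (rule mult_right_mono) simp
      then show "g y x ^ 4 \<le> K\<^sup>2 * (g y x)\<^sup>2"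
        by (simp add: power2_eq_square power4_eq_xxxx mult.assoc)
    qed
    also have "\<dots> = K\<^sup>2 * G x x" by (simp add: m2)
    also have "\<dots> \<le> K\<^sup>2 * \<beta>" using G_le[OF x x] by (intro mult_left_mono) auto
    finally have m4: "N.expectation (\<lambda>y. (g y x) ^ 4) \<le> K\<^sup>2 * \<beta>" .
    have "(G x x)\<^sup>2 \<le> \<beta>\<^sup>2" using power_mono[OF G_le[OF x x], of 2] by simp
    then show "expectation (\<lambda>\<omega>. (\<Sum>i<j. g (X i \<omega>) x) ^ 4) \<le> 3 * (real j)\<^sup>2 * \<beta>\<^sup>2 + real j * (K\<^sup>2 * \<beta>)"
      using m4 by (intro order_trans[OF expectation_sum_power4[OF bdd_g1[OF x] g_mean[OF x]]] add_mono mult_left_mono)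
        (auto simp: m2)
  qed
  finally show ?thesis by (simp add: N.prob_space)
qed

text \<open>Each new observation adds to the centred \<open>cond_var\<close> a term \<open>R\<close>
  with zero mean given the past, so second moments add up along the induction. With the newest point
  frozen, \<open>R\<close> is an i.i.d. sum of second moment at most a multiple of
  \<open>j w\<close>, plus a bounded diagonal part.\<close>

lemma expectation_cond_var: "expectation (\<lambda>\<omega>. cond_var j (\<lambda>i. X i \<omega>)) = real j * \<tau>"
  and variance_cond_var: "expectation (\<lambda>\<omega>. (cond_var j (\<lambda>i. X i \<omega>) - real j * \<tau>)\<^sup>2)
    \<le> 2 * real j * (4 * real j * w + \<beta>\<^sup>2)"
proof -
  \<comment> \<open>The new row and column of the matrix of values of \<open>G\<close>, equal by
    symmetry, and the new diagonal entry minus its mean.\<close>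
  define R where "R j y x = 2 * (\<Sum>i<j. G (y i) x) + (G x x - \<tau>)" for j :: nat and y x
  have step: "cond_var (Suc j) y - real (Suc j) * \<tau> = (cond_var j y - real j * \<tau>) + R j y (y j)" for j y
    unfolding cond_var_def R_def by (simp add: sum.distrib algebra_simps G_sym)
  have bddR: "bdd_measurable (PiM {..<j} (\<lambda>_. N) \<Otimes>\<^sub>M N) (\<lambda>(y, x). R j y x)" for j
    unfolding R_def
    by (auto simp: case_prod_beta' intro!: bdd_measurable_intros bdd_measurable_compose2[OF G_bdd])
  have bddR1: "bdd_measurable N (R j y)" if "\<And>i. i < j \<Longrightarrow> y i \<in> space N" for j y
    unfolding R_def using that by (auto intro!: bdd_measurable_intros bdd_G2 bdd_G_diag)
  have bddZ: "bdd_measurable (PiM {..<j} (\<lambda>_. N) \<Otimes>\<^sub>M N) (\<lambda>(y, x). cond_var j y - real j * \<tau>)" for j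
    unfolding cond_var_def
    by (auto simp: case_prod_beta' intro!: bdd_measurable_intros bdd_measurable_compose2[OF G_bdd])
  have bddZR: "bdd_measurable (PiM {..<j} (\<lambda>_. N) \<Otimes>\<^sub>M N)
    (\<lambda>(y, x). ((cond_var j y - real j * \<tau>) + R j y x) ^ p)" for j p
    using bdd_measurable_power[OF bdd_measurable_add[OF bddZ bddR]]
    by (simp add: case_prod_beta')
  have dep: "R j (\<lambda>i\<in>{..<j}. y i) x = R j y x" "cond_var j (\<lambda>i\<in>{..<j}. y i) = cond_var j y" for j y x
    unfolding R_def cond_var_def by simp_all
  have meanR: "N.expectation (R j y) = 0" if "\<And>i. i < j \<Longrightarrow> y i \<in> space N" for j y
  proof -
    have "N.expectation (\<lambda>x. G (y i) x) = 0" if "i < j" for i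
      using G_mean[of "y i"] that \<open>\<And>i. i < j \<Longrightarrow> y i \<in> space N\<close> G_sym by simp
    moreover have "integrable N (\<lambda>x. G (y i) x)" if "i < j" for i
      using that \<open>\<And>i. i < j \<Longrightarrow> y i \<in> space N\<close> by (intro N.integrable_bdd_measurable bdd_G2) auto
    moreover have "integrable N (\<lambda>x. G x x)"
      by (intro N.integrable_bdd_measurable bdd_G_diag)
    moreover have "integrable N (\<lambda>x. \<Sum>i<j. G (y i) x)"
      using calculation(2) by (intro Bochner_Integration.integrable_sum) auto
    moreover have "N.expectation (\<lambda>x. \<Sum>i<j. G (y i) x) = 0"
      using calculation(1,2) by (subst Bochner_Integration.integral_sum) auto
    ultimately show ?thesis
      unfolding R_def by (simp add: G_diag N.prob_space)
  qed
  have pow: "expectation (\<lambda>\<omega>. (cond_var (Suc j) (\<lambda>i. X i \<omega>) - real (Suc j) * \<tau>) ^ p)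
    = expectation (\<lambda>\<omega>. N.expectation (\<lambda>x. ((cond_var j (\<lambda>i. X i \<omega>) - real j * \<tau>) + R j (\<lambda>i. X i \<omega>) x) ^ p))"
    for j p
    unfolding step
    by (rule integrate_last[where F = "\<lambda>y x. ((cond_var j y - real j * \<tau>) + R j y x) ^ p", OF bddZR])
      (simp add: dep)
  have "expectation (\<lambda>\<omega>. cond_var j (\<lambda>i. X i \<omega>) - real j * \<tau>) = 0"
  proof (induction j)
    case (Suc j)
    have "N.expectation (\<lambda>x. (cond_var j (\<lambda>i. X i \<omega>) - real j * \<tau>) + R j (\<lambda>i. X i \<omega>) x)
        = cond_var j (\<lambda>i. X i \<omega>) - real j * \<tau>" if "\<omega> \<in> space M" for \<omega>
      using N.integrable_bdd_measurable[OF bddR1[of j "\<lambda>i. X i \<omega>"]] X_space[OF that]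
      by (simp add: meanR N.prob_space)
    then show ?case
      using pow[of j 1] Suc by (simp cong: Bochner_Integration.integral_cong)
  qed (simp add: cond_var_def)
  then show "expectation (\<lambda>\<omega>. cond_var j (\<lambda>i. X i \<omega>)) = real j * \<tau>"
    using integrable_bdd_measurable[OF bdd_cond_var[of j]] by (simp add: prob_space)
  have ER: "expectation (\<lambda>\<omega>. N.expectation (\<lambda>x. (R j (\<lambda>i. X i \<omega>) x)\<^sup>2)) \<le> 2 * (4 * real j * w + \<beta>\<^sup>2)" for j
  proof -
    have bd: "bdd_measurable (PiM {..<j} (\<lambda>_. N) \<Otimes>\<^sub>M N) (\<lambda>(y, x). (R j y x)\<^sup>2)"
      using bdd_measurable_power[OF bddR[of j], of 2] by (simp add: case_prod_beta')
    have bdRx: "bdd_measurable M (\<lambda>\<omega>. R j (\<lambda>i. X i \<omega>) x)" if "x \<in> space N" for x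
      unfolding R_def using that
      by (auto intro!: bdd_measurable_intros bdd_measurable_compose2[OF G_bdd])
    have "expectation (\<lambda>\<omega>. N.expectation (\<lambda>x. (R j (\<lambda>i. X i \<omega>) x)\<^sup>2))
      = N.expectation (\<lambda>x. expectation (\<lambda>\<omega>. (R j (\<lambda>i. X i \<omega>) x)\<^sup>2))"
      by (subst integrate_last[OF bd, symmetric], simp add: dep, subst integrate_last'[OF bd]) (auto simp: dep)
    also have "\<dots> \<le> N.expectation (\<lambda>x. 2 * (4 * real j * w + \<beta>\<^sup>2))"
    proof (intro integral_mono N.integrable_bdd_measurable bdd_measurable_const)
      have "bdd_measurable (N \<Otimes>\<^sub>M M) (\<lambda>(x, \<omega>). (R j (\<lambda>i. X i \<omega>) x)\<^sup>2)"
        unfolding R_def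
        by (auto simp: case_prod_beta' intro!: bdd_measurable_intros bdd_measurable_compose2[OF G_bdd])
      then show "bdd_measurable N (\<lambda>x. expectation (\<lambda>\<omega>. (R j (\<lambda>i. X i \<omega>) x)\<^sup>2))"
        by (rule bdd_measurable_lebesgue_integral[OF prob_space_axioms])
      fix x assume x: "x \<in> space N"
      let ?S = "\<lambda>\<omega>. \<Sum>i<j. G (X i \<omega>) x"
      have bdS: "bdd_measurable M ?S"
        using x by (auto intro!: bdd_measurable_intros bdd_measurable_compose2[OF G_bdd])
      \<comment> \<open>Both \<open>G x x\<close> and \<open>\<tau>\<close> lie between 0 and
        \<open>\<beta>\<close>.\<close>
      have "\<bar>G x x - \<tau>\<bar> \<le> \<beta>"
        using G_le[OF x x] G_diag_nonneg[OF x] tau_nonneg tau_le by linarith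
      then have Gt: "(G x x - \<tau>)\<^sup>2 \<le> \<beta>\<^sup>2"
        using power_mono[of "\<bar>G x x - \<tau>\<bar>" \<beta> 2] by simp
      have "expectation (\<lambda>\<omega>. (R j (\<lambda>i. X i \<omega>) x)\<^sup>2) \<le> expectation (\<lambda>\<omega>. 8 * (?S \<omega>)\<^sup>2 + 2 * \<beta>\<^sup>2)"
      proof (intro integral_mono integrable_bdd_measurable bdd_measurable_intros bdS bdRx x)
        fix \<omega>
        have "(2 * ?S \<omega> + (G x x - \<tau>))\<^sup>2 \<le> 2 * (2 * ?S \<omega>)\<^sup>2 + 2 * (G x x - \<tau>)\<^sup>2"
          using sum_squares_bound[of "2 * ?S \<omega>" "G x x - \<tau>"] by (simp add: power2_sum)
        then show "(R j (\<lambda>i. X i \<omega>) x)\<^sup>2 \<le> 8 * (?S \<omega>)\<^sup>2 + 2 * \<beta>\<^sup>2"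
          unfolding R_def using Gt by (simp add: power_mult_distrib)
      qed (use x in \<open>auto intro!: bdd_measurable_compose2[OF G_bdd]\<close>)
      also have "\<dots> = 8 * expectation (\<lambda>\<omega>. (?S \<omega>)\<^sup>2) + 2 * \<beta>\<^sup>2"
        using integrable_bdd_measurable[OF bdd_measurable_power[OF bdS, of 2]] by (simp add: prob_space)
      also have "expectation (\<lambda>\<omega>. (?S \<omega>)\<^sup>2) = real j * N.expectation (\<lambda>y. (G y x)\<^sup>2)"
        by (rule expectation_sum_power2[OF bdd_G1[OF x] G_mean[OF x]])
      also have "\<dots> \<le> real j * w"
        using G_square[OF x] by (intro mult_left_mono) auto
      finally show "expectation (\<lambda>\<omega>. (R j (\<lambda>i. X i \<omega>) x)\<^sup>2) \<le> 2 * (4 * real j * w + \<beta>\<^sup>2)" by simp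
    qed
    finally show ?thesis by (simp add: N.prob_space)
  qed
  show "expectation (\<lambda>\<omega>. (cond_var j (\<lambda>i. X i \<omega>) - real j * \<tau>)\<^sup>2) \<le> 2 * real j * (4 * real j * w + \<beta>\<^sup>2)"
  proof (induction j)
    case (Suc j)
    have sq: "N.expectation (\<lambda>x. ((cond_var j (\<lambda>i. X i \<omega>) - real j * \<tau>) + R j (\<lambda>i. X i \<omega>) x)\<^sup>2)
        = (cond_var j (\<lambda>i. X i \<omega>) - real j * \<tau>)\<^sup>2 + N.expectation (\<lambda>x. (R j (\<lambda>i. X i \<omega>) x)\<^sup>2)" if "\<omega> \<in> space M" for \<omega>
      using X_space[OF that] by (intro N.expectation_shift_power2 bddR1 meanR)
    have i1: "integrable M (\<lambda>\<omega>. (cond_var j (\<lambda>i. X i \<omega>) - real j * \<tau>)\<^sup>2)"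
      by (intro integrable_bdd_measurable bdd_measurable_intros bdd_cond_var)
    have "bdd_measurable (M \<Otimes>\<^sub>M N) (\<lambda>(\<omega>, x). (R j (\<lambda>i. X i \<omega>) x)\<^sup>2)"
      unfolding R_def
      by (auto simp: case_prod_beta' intro!: bdd_measurable_intros bdd_measurable_compose2[OF G_bdd])
    then have i2: "integrable M (\<lambda>\<omega>. N.expectation (\<lambda>x. (R j (\<lambda>i. X i \<omega>) x)\<^sup>2))"
      by (intro integrable_bdd_measurable bdd_measurable_lebesgue_integral[OF N.prob_space_axioms])
    have "expectation (\<lambda>\<omega>. (cond_var (Suc j) (\<lambda>i. X i \<omega>) - real (Suc j) * \<tau>)\<^sup>2)
      = expectation (\<lambda>\<omega>. (cond_var j (\<lambda>i. X i \<omega>) - real j * \<tau>)\<^sup>2)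
        + expectation (\<lambda>\<omega>. N.expectation (\<lambda>x. (R j (\<lambda>i. X i \<omega>) x)\<^sup>2))"
      unfolding pow by (simp only: sq Bochner_Integration.integral_add[OF i1 i2] cong: Bochner_Integration.integral_cong)
    also have "\<dots> \<le> 2 * real j * (4 * real j * w + \<beta>\<^sup>2) + 2 * (4 * real j * w + \<beta>\<^sup>2)"
      using Suc ER[of j] by linarith
    also have "\<dots> = 2 * real (Suc j) * (4 * real j * w + \<beta>\<^sup>2)" by (simp add: algebra_simps)
    \<comment> \<open>Raising \<open>j\<close> to \<open>j + 1\<close> inside the bracket restores
      the shape required by the induction.\<close>
    also have "\<dots> \<le> 2 * real (Suc j) * (4 * real (Suc j) * w + \<beta>\<^sup>2)"
      using w_nonneg by (intro mult_left_mono add_mono mult_right_mono) auto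
    finally show ?case .
  qed (simp add: cond_var_def)
qed

text \<open>Given the first \<open>j\<close> observations, the new factor becomes the conditional
  characteristic function of the increment, which \<open>char_approx_normal\<close> compares with
  that of a normal variable of variance \<open>j \<tau>\<close>, the mean of
  \<open>cond_var j\<close>. The factor from the past has modulus one and does not enlarge the
  error. \<open>d\<close> weights the third moment and \<open>d'\<close> the deviation of the
  conditional variance.\<close>

lemma char_increment:
  assumes d: "d > 0" and d': "d' > 0"
  shows "cmod ((CLINT \<omega>|M. iexp (t * U (Suc j) \<omega>))
      - of_real (exp (- (t\<^sup>2 * (real j * \<tau>) / 2))) * (CLINT \<omega>|M. iexp (t * U j \<omega>)))
    \<le> \<bar>t\<bar> ^ 3 / 12 * (d * (real j * \<tau>) + (3 * (real j)\<^sup>2 * \<beta>\<^sup>2 + real j * (K\<^sup>2 * \<beta>)) / d)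
      + t\<^sup>2 / 2 * ((d' + 2 * real j * (4 * real j * w + \<beta>\<^sup>2) / d') / 2) + t ^ 4 * (real j * \<tau>)\<^sup>2 / 8"
proof -
  define u where "u y = (\<Sum>b<j. \<Sum>a<b. g (y a) (y b))" for y
  define D where "D y x = (\<Sum>i<j. g (y i) x)" for y x
  let ?Y = "\<lambda>\<omega> i. X i \<omega>"
  let ?q = "\<lambda>\<omega>. cond_var j (?Y \<omega>)"
  let ?m4 = "\<lambda>\<omega>. N.expectation (\<lambda>x. D (?Y \<omega>) x ^ 4)"
  define e where "e = exp (- (t\<^sup>2 * (real j * \<tau>) / 2))"
  define \<psi> where "\<psi> \<omega> = (CLINT x|N. iexp (t * D (?Y \<omega>) x))" for \<omega>
  have Uj: "U j \<omega> = u (?Y \<omega>)" and USuc: "U (Suc j) \<omega> = u (?Y \<omega>) + D (?Y \<omega>) (X j \<omega>)" for \<omega>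
    by (simp_all add: U_def u_def D_def)
  have D_bdd: "bdd_measurable N (D (?Y \<omega>))" if "\<omega> \<in> space M" for \<omega>
    unfolding D_def using X_space[OF that] by (intro bdd_measurable_intros bdd_g2)
  have D_bdd': "bdd_measurable (M \<Otimes>\<^sub>M N) (\<lambda>(\<omega>, x). D (?Y \<omega>) x)"
    unfolding D_def
    by (auto simp: case_prod_beta' intro!: bdd_measurable_intros bdd_measurable_compose2[OF g_bdd])
  have bd: "bdd_measurable (PiM {..<j} (\<lambda>_. N) \<Otimes>\<^sub>M N) (\<lambda>(y, x). iexp (t * (u y + D y x)))"
    unfolding u_def D_def case_prod_beta'
    by (intro bdd_measurable_intros bdd_measurable_compose2[OF g_bdd]) auto
  have "bdd_measurable (M \<Otimes>\<^sub>M N) (\<lambda>(\<omega>, x). iexp (t * D (?Y \<omega>) x))"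
    using bdd_measurable_iexp[OF bdd_measurable_mult[OF bdd_measurable_const[of _ t] D_bdd']]
    by (simp add: case_prod_beta')
  then have psi_bdd: "bdd_measurable M \<psi>"
    unfolding \<psi>_def by (rule bdd_measurable_lebesgue_integral[OF N.prob_space_axioms])
  have "bdd_measurable (M \<Otimes>\<^sub>M N) (\<lambda>(\<omega>, x). D (?Y \<omega>) x ^ 4)"
    using bdd_measurable_power[OF D_bdd', of 4] by (simp add: case_prod_beta')
  then have m4_bdd: "bdd_measurable M ?m4"
    by (rule bdd_measurable_lebesgue_integral[OF N.prob_space_axioms])
  have "(CLINT \<omega>|M. iexp (t * U (Suc j) \<omega>)) = (CLINT \<omega>|M. (CLINT x|N. iexp (t * (u (?Y \<omega>) + D (?Y \<omega>) x))))"
    unfolding USuc by (rule integrate_last[OF bd]) (simp add: u_def D_def)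
  also have "\<dots> = (CLINT \<omega>|M. iexp (t * U j \<omega>) * \<psi> \<omega>)"
    unfolding \<psi>_def Uj by (simp add: distrib_left exp_add)
  finally have "(CLINT \<omega>|M. iexp (t * U (Suc j) \<omega>)) - of_real e * (CLINT \<omega>|M. iexp (t * U j \<omega>))
      = (CLINT \<omega>|M. iexp (t * U j \<omega>) * \<psi> \<omega>) - (CLINT \<omega>|M. of_real e * iexp (t * U j \<omega>))"
    by simp
  also have "\<dots> = (CLINT \<omega>|M. iexp (t * U j \<omega>) * \<psi> \<omega> - of_real e * iexp (t * U j \<omega>))"
    by (intro Bochner_Integration.integral_diff[symmetric] integrable_bdd_measurable
        bdd_measurable_intros bdd_U psi_bdd)
  also have "cmod \<dots> \<le> expectation (\<lambda>\<omega>. cmod (iexp (t * U j \<omega>) * \<psi> \<omega> - of_real e * iexp (t * U j \<omega>)))"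
    by (rule integral_norm_bound)
  also have "\<dots> \<le> expectation (\<lambda>\<omega>. \<bar>t\<bar> ^ 3 / 12 * (d * ?q \<omega> + ?m4 \<omega> / d)
      + t\<^sup>2 / 2 * ((d' + (?q \<omega> - real j * \<tau>)\<^sup>2 / d') / 2) + t ^ 4 * (real j * \<tau>)\<^sup>2 / 8)" (is "_ \<le> expectation ?B")
  proof (rule integral_mono)
    show "integrable M (\<lambda>\<omega>. cmod (iexp (t * U j \<omega>) * \<psi> \<omega> - of_real e * iexp (t * U j \<omega>)))"
      by (intro integrable_norm integrable_bdd_measurable bdd_measurable_intros bdd_U psi_bdd)
    show "integrable M ?B"
      by (intro integrable_bdd_measurable bdd_measurable_intros bdd_cond_var m4_bdd)
    fix \<omega> assume \<omega>: "\<omega> \<in> space M"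
    have "iexp (t * U j \<omega>) * \<psi> \<omega> - of_real e * iexp (t * U j \<omega>) = iexp (t * U j \<omega>) * (\<psi> \<omega> - of_real e)"
      by (simp add: algebra_simps)
    then have "cmod (iexp (t * U j \<omega>) * \<psi> \<omega> - of_real e * iexp (t * U j \<omega>)) = cmod (\<psi> \<omega> - of_real e)"
      by (simp add: norm_mult del: of_real_mult)
    also have "\<dots> \<le> \<bar>t\<bar> ^ 3 / 12 * (d * ?q \<omega> + ?m4 \<omega> / d)
      + t\<^sup>2 / 2 * \<bar>?q \<omega> - real j * \<tau>\<bar> + t ^ 4 * (real j * \<tau>)\<^sup>2 / 8"
      using N.char_approx_normal[OF D_bdd[OF \<omega>] _ d, of "real j * \<tau>" t]
        increment_mean[of j "?Y \<omega>"] increment_square[of j "?Y \<omega>"] X_space[OF \<omega>] tau_nonneg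
      unfolding \<psi>_def e_def D_def by simp
    also have "\<dots> \<le> ?B \<omega>"
      \<comment> \<open>The absolute deviation is traded for its square, whose expectation
        \<open>variance_cond_var\<close> controls.\<close>
      using abs_le_square[OF d', of "?q \<omega> - real j * \<tau>"]
      by (intro add_mono mult_left_mono order_refl) auto
    finally show "cmod (iexp (t * U j \<omega>) * \<psi> \<omega> - of_real e * iexp (t * U j \<omega>)) \<le> ?B \<omega>" .
  qed
  also have "\<dots> = \<bar>t\<bar> ^ 3 / 12 * (d * (real j * \<tau>) + expectation ?m4 / d)
      + t\<^sup>2 / 2 * ((d' + expectation (\<lambda>\<omega>. (?q \<omega> - real j * \<tau>)\<^sup>2) / d') / 2) + t ^ 4 * (real j * \<tau>)\<^sup>2 / 8"
  proof -
    have "integrable M (\<lambda>\<omega>. (?q \<omega> - real j * \<tau>)\<^sup>2)" "integrable M ?q" "integrable M ?m4"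
      by (intro integrable_bdd_measurable bdd_measurable_intros bdd_cond_var m4_bdd)+
    then show ?thesis by (simp add: expectation_cond_var prob_space)
  qed
  also have "\<dots> \<le> \<bar>t\<bar> ^ 3 / 12 * (d * (real j * \<tau>) + (3 * (real j)\<^sup>2 * \<beta>\<^sup>2 + real j * (K\<^sup>2 * \<beta>)) / d)
      + t\<^sup>2 / 2 * ((d' + 2 * real j * (4 * real j * w + \<beta>\<^sup>2) / d') / 2) + t ^ 4 * (real j * \<tau>)\<^sup>2 / 8"
    using expectation_increment_power4[of j] variance_cond_var[of j] d d'
    by (intro add_mono mult_left_mono divide_right_mono order_refl) (auto simp: D_def)
  finally show ?thesis unfolding e_def .
qed

text \<open>Factors are replaced one at a time. The target variances \<open>j \<tau>\<close> for
  \<open>j < n\<close> add up to \<open>\<tau> n (n - 1) / 2\<close>, and normal factors already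
  inserted are at most one, so earlier errors are not amplified. The step errors increase with
  \<open>j\<close>, hence \<open>n\<close> copies of the bound at \<open>n\<close> suffice.\<close>

lemma char_U_approx:
  assumes d: "d > 0" and d': "d' > 0"
  shows "cmod ((CLINT \<omega>|M. iexp (t * U n \<omega>)) - of_real (exp (- (t\<^sup>2 * \<tau> * (real n * (real n - 1)) / 4))))
    \<le> real n * (\<bar>t\<bar> ^ 3 / 12 * (d * (real n * \<tau>) + (3 * (real n)\<^sup>2 * \<beta>\<^sup>2 + real n * (K\<^sup>2 * \<beta>)) / d)
      + t\<^sup>2 / 2 * ((d' + 2 * real n * (4 * real n * w + \<beta>\<^sup>2) / d') / 2) + t ^ 4 * (real n * \<tau>)\<^sup>2 / 8)"
proof -
  define err where "err j = \<bar>t\<bar> ^ 3 / 12 * (d * (real j * \<tau>) + (3 * (real j)\<^sup>2 * \<beta>\<^sup>2 + real j * (K\<^sup>2 * \<beta>)) / d)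
      + t\<^sup>2 / 2 * ((d' + 2 * real j * (4 * real j * w + \<beta>\<^sup>2) / d') / 2) + t ^ 4 * (real j * \<tau>)\<^sup>2 / 8" for j
  have err_mono: "err j \<le> err n" if "j \<le> n" for j
    unfolding err_def using that d d' tau_nonneg tau_le w_nonneg
    by (intro add_mono mult_left_mono divide_right_mono mult_mono power_mono order_refl) auto
  have "cmod ((CLINT \<omega>|M. iexp (t * U m \<omega>)) - of_real (exp (- (t\<^sup>2 * \<tau> * (real m * (real m - 1)) / 4))))
    \<le> real m * err n" if "m \<le> n" for m
    using that
  proof (induction m)
    case 0
    then show ?case by (simp add: U_def prob_space)
  next
    case (Suc m)
    define e where "e = exp (- (t\<^sup>2 * (real m * \<tau>) / 2))"
    let ?c = "\<lambda>m. CLINT \<omega>|M. iexp (t * U m \<omega>)"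
    let ?n = "\<lambda>m. exp (- (t\<^sup>2 * \<tau> * (real m * (real m - 1)) / 4))"
    have n: "?n (Suc m) = e * ?n m"
      unfolding e_def exp_add[symmetric] by (simp add: field_simps)
    have e: "0 \<le> e" "e \<le> 1" using tau_nonneg by (auto simp: e_def)
    have "?c (Suc m) - of_real (?n (Suc m)) = (?c (Suc m) - of_real e * ?c m) + of_real e * (?c m - of_real (?n m))"
      unfolding n by (simp add: algebra_simps)
    also have "cmod \<dots> \<le> err m + e * cmod (?c m - of_real (?n m))"
    proof (rule norm_triangle_mono)
      show "cmod (?c (Suc m) - of_real e * ?c m) \<le> err m"
        unfolding err_def e_def by (rule char_increment[OF d d'])
    qed (use e in \<open>simp add: norm_mult\<close>)
    also have "\<dots> \<le> err n + 1 * (real m * err n)"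
      using Suc e err_mono[of m] by (intro add_mono mult_mono) auto
    finally show ?case by (simp add: algebra_simps)
  qed
  from this[of n] show ?thesis by (simp add: err_def)
qed

end

subsection \<open>Kernels with a bounded orthonormal system\<close>

locale bounded_orthonormal = prob_space N for N :: "'a measure" +
  fixes phi :: "nat \<Rightarrow> 'a \<Rightarrow> real" and B :: real
  assumes phi_measurable [measurable]: "\<And>k. phi k \<in> borel_measurable N"
    and phi_mean: "\<And>k. expectation (phi k) = 0"
    and phi_ortho: "\<And>j k. expectation (\<lambda>x. phi j x * phi k x) = (if j = k then 1 else 0)"
    and phi_le: "\<And>k x. x \<in> space N \<Longrightarrow> \<bar>phi k x\<bar> \<le> B"
begin

lemma B_nonneg: "0 \<le> B"
proof -
  obtain x where "x \<in> space N" using not_empty by blast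
  from phi_le[OF this, of 0] show ?thesis by linarith
qed

lemma phi_bdd: "bdd_measurable N (phi k)"
  by (rule bdd_measurableI[of _ _ B]) (auto simp: phi_le)

lemma phi_mult_le: "x \<in> space N \<Longrightarrow> y \<in> space N \<Longrightarrow> \<bar>phi k x * phi k y\<bar> \<le> B\<^sup>2"
  unfolding abs_mult power2_eq_square by (intro mult_mono phi_le B_nonneg) auto

definition series :: "(nat \<Rightarrow> real) \<Rightarrow> 'a \<Rightarrow> real" where
  "series c x = (\<Sum>k. c k * phi k x)"

text \<open>The kernel of the operator that is diagonal in \<open>phi\<close> with eigenvalues
  \<open>a\<close>; the shrinkage weights give \<open>Ktilde\<close>.\<close>

definition kern :: "(nat \<Rightarrow> real) \<Rightarrow> 'a \<Rightarrow> 'a \<Rightarrow> real" where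
  "kern a x y = (\<Sum>k. a k * phi k x * phi k y)"

text \<open>A constant dominating all partial sums at once, the majorant for the dominated
  convergence arguments below.\<close>

lemma abs_partial_le:
  assumes c: "summable (\<lambda>k. \<bar>c k\<bar>)" and x: "x \<in> space N"
  shows "\<bar>\<Sum>k<n. c k * phi k x\<bar> \<le> B * (\<Sum>k. \<bar>c k\<bar>)"
proof -
  have "\<bar>\<Sum>k<n. c k * phi k x\<bar> \<le> (\<Sum>k<n. B * \<bar>c k\<bar>)"
    using phi_le[OF x] by (intro sum_abs[THEN order_trans] sum_mono)
      (auto simp: abs_mult mult.commute[of B] intro!: mult_left_mono)
  also have "\<dots> \<le> B * (\<Sum>k. \<bar>c k\<bar>)"
    unfolding sum_distrib_left[symmetric] by (intro mult_left_mono sum_le_suminf c B_nonneg) auto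
  finally show ?thesis .
qed

lemma summable_series:
  assumes c: "summable (\<lambda>k. \<bar>c k\<bar>)" and x: "x \<in> space N"
  shows "summable (\<lambda>k. \<bar>c k * phi k x\<bar>)"
  by (rule summable_comparison_test[OF _ summable_mult[OF c, of B]])
    (use phi_le[OF x] in \<open>auto simp: abs_mult mult.commute[of B] intro!: exI[of _ 0] mult_left_mono\<close>)

lemma tendsto_series:
  assumes "summable (\<lambda>k. \<bar>c k\<bar>)" "x \<in> space N"
  shows "(\<lambda>n. \<Sum>k<n. c k * phi k x) \<longlonglongrightarrow> series c x"
  unfolding series_def
  using summable_LIMSEQ[OF summable_rabs_cancel[OF summable_series[OF assms]]] .

lemma series_measurable [measurable]: "series c \<in> borel_measurable N"
  unfolding series_def by measurable

lemma series_mean: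
  assumes c: "summable (\<lambda>k. \<bar>c k\<bar>)"
  shows "expectation (series c) = 0"
proof -
  have "(\<lambda>n. expectation (\<lambda>x. \<Sum>k<n. c k * phi k x)) \<longlonglongrightarrow> expectation (series c)"
    by (rule integral_dominated_convergence[where w = "\<lambda>_. B * (\<Sum>k. \<bar>c k\<bar>)"])
      (auto intro!: tendsto_series abs_partial_le c)
  moreover have "expectation (\<lambda>x. \<Sum>k<n. c k * phi k x) = 0" for n
    by (subst Bochner_Integration.integral_sum)
      (auto intro!: integrable_bdd_measurable bdd_measurable_intros phi_bdd simp: phi_mean)
  ultimately show ?thesis by (simp add: LIMSEQ_const_iff)
qed

text \<open>Parseval's identity. For finite sums it is orthonormality; absolute summability together
  with the uniform bound on \<open>phi\<close> lets dominated convergence pass to the limit.\<close>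

lemma series_inner:
  assumes c: "summable (\<lambda>k. \<bar>c k\<bar>)" and d: "summable (\<lambda>k. \<bar>d k\<bar>)"
  shows "expectation (\<lambda>x. series c x * series d x) = (\<Sum>k. c k * d k)"
proof -
  have B0: "0 \<le> B * (\<Sum>k. \<bar>c k\<bar>)"
    by (intro mult_nonneg_nonneg B_nonneg suminf_nonneg c) auto
  have "(\<lambda>n. expectation (\<lambda>x. (\<Sum>k<n. c k * phi k x) * (\<Sum>k<n. d k * phi k x)))
      \<longlonglongrightarrow> expectation (\<lambda>x. series c x * series d x)"
    by (rule integral_dominated_convergence[where w = "\<lambda>_. (B * (\<Sum>k. \<bar>c k\<bar>)) * (B * (\<Sum>k. \<bar>d k\<bar>))"])
      (auto intro!: tendsto_mult tendsto_series c d AE_I2 mult_mono[OF abs_partial_le abs_partial_le] B0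
        simp: abs_mult)
  moreover have "expectation (\<lambda>x. (\<Sum>k<n. c k * phi k x) * (\<Sum>k<n. d k * phi k x)) = (\<Sum>k<n. c k * d k)" for n
  proof -
    have i: "integrable N (\<lambda>x. c j * d k * (phi j x * phi k x))" for j k
      by (intro integrable_bdd_measurable bdd_measurable_intros phi_bdd)
    have "expectation (\<lambda>x. (\<Sum>k<n. c k * phi k x) * (\<Sum>k<n. d k * phi k x))
       = expectation (\<lambda>x. \<Sum>j<n. \<Sum>k<n. c j * d k * (phi j x * phi k x))"
      by (simp add: sum_product mult_ac)
    also have "\<dots> = (\<Sum>j<n. expectation (\<lambda>x. \<Sum>k<n. c j * d k * (phi j x * phi k x)))"
      by (intro Bochner_Integration.integral_sum Bochner_Integration.integrable_sum i)
    also have "\<dots> = (\<Sum>j<n. \<Sum>k<n. expectation (\<lambda>x. c j * d k * (phi j x * phi k x)))"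
      by (intro sum.cong refl Bochner_Integration.integral_sum i)
    also have "\<dots> = (\<Sum>j<n. \<Sum>k<n. if j = k then c j * d k else 0)"
      by (intro sum.cong refl) (simp add: phi_ortho)
    also have "\<dots> = (\<Sum>k<n. c k * d k)" by simp
    finally show ?thesis .
  qed
  ultimately have "(\<lambda>k. c k * d k) sums expectation (\<lambda>x. series c x * series d x)"
    by (simp add: sums_def)
  then show ?thesis by (rule sums_unique)
qed

lemma kern_series: "kern a x y = series (\<lambda>k. a k * phi k y) x"
  unfolding kern_def series_def by (simp add: mult_ac)

lemma kern_sym: "kern a x y = kern a y x"
  unfolding kern_def by (simp add: mult_ac)

section \<open>Kernels with absolutely summable eigenvalues\<close>

context
  fixes a :: "nat \<Rightarrow> real"
  assumes a_summable: "summable (\<lambda>k. \<bar>a k\<bar>)"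
begin

lemma kern_coeff_summable: "y \<in> space N \<Longrightarrow> summable (\<lambda>k. \<bar>a k * phi k y\<bar>)"
  by (rule summable_series[OF a_summable])

lemma kern_summable:
  "x \<in> space N \<Longrightarrow> y \<in> space N \<Longrightarrow> summable (\<lambda>k. \<bar>a k * phi k x * phi k y\<bar>)"
  by (rule summable_series[OF kern_coeff_summable])

lemma kern_le:
  assumes "x \<in> space N" "y \<in> space N"
  shows "\<bar>kern a x y\<bar> \<le> B\<^sup>2 * (\<Sum>k. \<bar>a k\<bar>)"
proof -
  have "\<bar>kern a x y\<bar> \<le> (\<Sum>k. \<bar>a k * phi k x * phi k y\<bar>)"
    unfolding kern_def by (rule summable_rabs[OF kern_summable[OF assms]])
  also have "\<dots> \<le> (\<Sum>k. B\<^sup>2 * \<bar>a k\<bar>)"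
  proof (rule suminf_le)
    fix k
    show "\<bar>a k * phi k x * phi k y\<bar> \<le> B\<^sup>2 * \<bar>a k\<bar>"
      using mult_left_mono[OF phi_mult_le[OF assms, of k], of "\<bar>a k\<bar>"] by (simp add: abs_mult mult_ac)
  qed (intro kern_summable assms summable_mult a_summable)+
  also have "\<dots> = B\<^sup>2 * (\<Sum>k. \<bar>a k\<bar>)" by (rule suminf_mult[OF a_summable])
  finally show ?thesis .
qed

lemma kern_bdd: "bdd_measurable (N \<Otimes>\<^sub>M N) (\<lambda>(x, y). kern a x y)"
proof (rule bdd_measurableI)
  show "(\<lambda>(x, y). kern a x y) \<in> borel_measurable (N \<Otimes>\<^sub>M N)"
    unfolding kern_def by measurable
qed (auto simp: space_pair_measure intro!: kern_le)

lemma kern_mean: "y \<in> space N \<Longrightarrow> expectation (\<lambda>x. kern a x y) = 0"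
  unfolding kern_series by (rule series_mean[OF kern_coeff_summable])

text \<open>Composing the operator with itself squares its eigenvalues: this is
  \<open>series_inner\<close> for the coefficients \<open>a k * phi k y\<close> and
  \<open>a k * phi k y'\<close>.\<close>

lemma kern_square:
  assumes "y \<in> space N" "y' \<in> space N"
  shows "expectation (\<lambda>x. kern a x y * kern a x y') = kern (\<lambda>k. (a k)\<^sup>2) y y'"
  unfolding kern_series using assms
  by (subst series_inner) (auto intro!: kern_coeff_summable simp: series_def power2_eq_square mult_ac)

text \<open>The trace formula: each squared \<open>phi k\<close> integrates to one, and the partial
  sums on the diagonal are uniformly bounded.\<close>

lemma kern_diag_mean: "expectation (\<lambda>x. kern a x x) = (\<Sum>k. a k)"
proof -
  have "(\<lambda>n. expectation (\<lambda>x. \<Sum>k<n. a k * phi k x * phi k x)) \<longlonglongrightarrow> expectation (\<lambda>x. kern a x x)"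
  \<comment> \<open>One factor \<open>B\<close> comes from \<open>abs_partial_le\<close> for the
    coefficients \<open>a k * phi k x\<close>, the other from bounding these coefficients.\<close>
  proof (rule integral_dominated_convergence[where w = "\<lambda>_. B * (B * (\<Sum>k. \<bar>a k\<bar>))"])
    show "(\<lambda>x. kern a x x) \<in> borel_measurable N" unfolding kern_def by measurable
    show "AE x in N. (\<lambda>n. \<Sum>k<n. a k * phi k x * phi k x) \<longlonglongrightarrow> kern a x x"
      unfolding kern_def
      by (intro AE_I2 summable_LIMSEQ summable_rabs_cancel[OF kern_summable])
    fix n
    show "AE x in N. norm (\<Sum>k<n. a k * phi k x * phi k x) \<le> B * (B * (\<Sum>k. \<bar>a k\<bar>))"
    proof (rule AE_I2)
      fix x assume x: "x \<in> space N"
      have "(\<Sum>k. \<bar>a k * phi k x\<bar>) \<le> (\<Sum>k. B * \<bar>a k\<bar>)"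
      proof (rule suminf_le)
        show "\<bar>a k * phi k x\<bar> \<le> B * \<bar>a k\<bar>" for k
          using mult_left_mono[OF phi_le[OF x, of k], of "\<bar>a k\<bar>"] by (simp add: abs_mult mult_ac)
      qed (intro kern_coeff_summable x summable_mult a_summable)+
      also have "\<dots> = B * (\<Sum>k. \<bar>a k\<bar>)" by (rule suminf_mult[OF a_summable])
      finally have "B * (\<Sum>k. \<bar>a k * phi k x\<bar>) \<le> B * (B * (\<Sum>k. \<bar>a k\<bar>))"
        by (intro mult_left_mono B_nonneg)
      then show "norm (\<Sum>k<n. a k * phi k x * phi k x) \<le> B * (B * (\<Sum>k. \<bar>a k\<bar>))"
        using abs_partial_le[OF kern_coeff_summable[OF x] x, of n] by simp
    qed
  qed auto
  moreover have "expectation (\<lambda>x. \<Sum>k<n. a k * phi k x * phi k x) = (\<Sum>k<n. a k)" for n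
  proof -
    have "expectation (\<lambda>x. \<Sum>k<n. a k * phi k x * phi k x)
       = (\<Sum>k<n. expectation (\<lambda>x. a k * (phi k x * phi k x)))"
      unfolding mult.assoc
      by (intro Bochner_Integration.integral_sum integrable_bdd_measurable bdd_measurable_intros phi_bdd)
    then show ?thesis by (simp add: phi_ortho)
  qed
  ultimately have "a sums expectation (\<lambda>x. kern a x x)" by (simp add: sums_def)
  then show ?thesis by (rule sums_unique)
qed

end

end

text \<open>Evaluates the bound of \<open>char_U_approx\<close> for the rescaled kernel with weights
  \<open>\<delta>\<close> and \<open>\<delta> / n\<close>. The moment terms become multiples of
  \<open>\<delta>\<close> or are bounded by multiples of \<open>\<delta>^2 / \<delta>\<close>, so
  taking \<open>\<delta>\<close> as a square root balances them. The term in \<open>1 / n\<close> is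
  the remainder of the real exponential.\<close>

lemma error_bound_rescaled:
  fixes n v S b t :: real
  assumes n: "n > 0" and v: "v > 0" and S: "S \<ge> 0" and b: "b \<ge> 0"
  defines "r \<equiv> 2 / (n * sqrt v)" and "\<delta> \<equiv> sqrt (1 / n + S\<^sup>2 / (n\<^sup>2 * v) + 1 / v)"
  shows "n * (\<bar>t\<bar> ^ 3 / 12 * (\<delta> * (n * (r\<^sup>2 * v))
        + (3 * n\<^sup>2 * (r\<^sup>2 * (b * v))\<^sup>2 + n * ((r * (b * S))\<^sup>2 * (r\<^sup>2 * (b * v)))) / \<delta>)
      + t\<^sup>2 / 2 * ((\<delta> / n + 2 * n * (4 * n * (r ^ 4 * (b * v)) + (r\<^sup>2 * (b * v))\<^sup>2) / (\<delta> / n)) / 2)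
      + t ^ 4 * (n * (r\<^sup>2 * v))\<^sup>2 / 8)
    \<le> (\<bar>t\<bar> ^ 3 / 12 * (4 + 48 * b\<^sup>2 + 16 * b ^ 3) + t\<^sup>2 / 4 * (1 + 128 * b + 32 * b\<^sup>2)) * \<delta> + 2 * t ^ 4 / n"
proof -
  define R where "R = 1 / n + S\<^sup>2 / (n\<^sup>2 * v) + 1 / v"
  have R: "1 / n \<le> R" "S\<^sup>2 / (n\<^sup>2 * v) \<le> R" "1 / v \<le> R" "R > 0"
    using n v by (auto simp: R_def add_pos_nonneg add_nonneg_pos)
  have \<delta>: "\<delta> > 0" "\<delta>\<^sup>2 = R" using R by (simp_all add: \<delta>_def R_def[symmetric])
  then have R\<delta>: "R / \<delta> = \<delta>" by (simp add: power2_eq_square flip: \<delta>(2))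
  have r2: "r\<^sup>2 = 4 / (n\<^sup>2 * v)"
    using v by (simp add: r_def power_divide power_mult_distrib)
  have r4: "r ^ 4 = 16 / (n ^ 4 * v\<^sup>2)"
  proof -
    have "r ^ 4 = (r\<^sup>2)\<^sup>2" by (simp flip: power_mult)
    then show ?thesis unfolding r2 by (simp add: power_divide power_mult_distrib flip: power_mult)
  qed
  have nv: "n \<noteq> 0" "v \<noteq> 0" using n v by auto
  \<comment> \<open>The four contributions after multiplication by \<open>n\<close>.
    \<open>T3\<close> carries an additional \<open>n\<close> from the division by
    \<open>\<delta> / n\<close>.\<close>
  have T1: "n * (n * (r\<^sup>2 * v)) = 4"
    unfolding r2 using nv by (simp add: field_simps power2_eq_square)
  have T2: "n * (3 * n\<^sup>2 * (r\<^sup>2 * (b * v))\<^sup>2 + n * ((r * (b * S))\<^sup>2 * (r\<^sup>2 * (b * v))))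
     = 48 * b\<^sup>2 * (1 / n) + 16 * b ^ 3 * (S\<^sup>2 / (n\<^sup>2 * v))"
    unfolding power_mult_distrib r2 using nv by (simp add: field_simps eval_nat_numeral)
  have T3: "n * (2 * n * (4 * n * (r ^ 4 * (b * v)) + (r\<^sup>2 * (b * v))\<^sup>2) * n)
     = 128 * b * (1 / v) + 32 * b\<^sup>2 * (1 / n)"
    unfolding r2 r4 using nv by (simp add: field_simps eval_nat_numeral)
  have T4: "n * (n * (r\<^sup>2 * v))\<^sup>2 = 16 / n"
    unfolding r2 using nv by (simp add: field_simps eval_nat_numeral)
  have "n * (\<bar>t\<bar> ^ 3 / 12 * (\<delta> * (n * (r\<^sup>2 * v))
        + (3 * n\<^sup>2 * (r\<^sup>2 * (b * v))\<^sup>2 + n * ((r * (b * S))\<^sup>2 * (r\<^sup>2 * (b * v)))) / \<delta>)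
      + t\<^sup>2 / 2 * ((\<delta> / n + 2 * n * (4 * n * (r ^ 4 * (b * v)) + (r\<^sup>2 * (b * v))\<^sup>2) / (\<delta> / n)) / 2)
      + t ^ 4 * (n * (r\<^sup>2 * v))\<^sup>2 / 8)
    = \<bar>t\<bar> ^ 3 / 12 * (\<delta> * (n * (n * (r\<^sup>2 * v)))
        + n * (3 * n\<^sup>2 * (r\<^sup>2 * (b * v))\<^sup>2 + n * ((r * (b * S))\<^sup>2 * (r\<^sup>2 * (b * v)))) / \<delta>)
      + t\<^sup>2 / 4 * (n * (\<delta> / n) + n * (2 * n * (4 * n * (r ^ 4 * (b * v)) + (r\<^sup>2 * (b * v))\<^sup>2) * n) / \<delta>)
      + t ^ 4 * (n * (n * (r\<^sup>2 * v))\<^sup>2) / 8"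
    by (simp add: algebra_simps add_divide_distrib)
  also have "\<dots> = \<bar>t\<bar> ^ 3 / 12 * (\<delta> * 4 + (48 * b\<^sup>2 * (1 / n) + 16 * b ^ 3 * (S\<^sup>2 / (n\<^sup>2 * v))) / \<delta>)
      + t\<^sup>2 / 4 * (\<delta> + (128 * b * (1 / v) + 32 * b\<^sup>2 * (1 / n)) / \<delta>) + t ^ 4 * (16 / n) / 8"
    unfolding T1 T2 T3 T4 using nv by simp
  also have "\<dots> \<le> \<bar>t\<bar> ^ 3 / 12 * (\<delta> * 4 + (48 * b\<^sup>2 * R + 16 * b ^ 3 * R) / \<delta>)
      + t\<^sup>2 / 4 * (\<delta> + (128 * b * R + 32 * b\<^sup>2 * R) / \<delta>) + t ^ 4 * (16 / n) / 8"
    using \<delta> R b by (intro add_mono mult_left_mono divide_right_mono order_refl) auto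
  also have "\<dots> = \<bar>t\<bar> ^ 3 / 12 * (\<delta> * 4 + (48 * b\<^sup>2 + 16 * b ^ 3) * (R / \<delta>))
      + t\<^sup>2 / 4 * (\<delta> + (128 * b + 32 * b\<^sup>2) * (R / \<delta>)) + t ^ 4 * (16 / n) / 8"
    by (simp add: distrib_right add_divide_distrib)
  also have "\<dots> = (\<bar>t\<bar> ^ 3 / 12 * (4 + 48 * b\<^sup>2 + 16 * b ^ 3) + t\<^sup>2 / 4 * (1 + 128 * b + 32 * b\<^sup>2)) * \<delta> + 2 * t ^ 4 / n"
    unfolding R\<delta> by (simp add: algebra_simps)
  finally show ?thesis .
qed

locale iid_bounded_orthonormal = iid_seq M N X + N: bounded_orthonormal N phi B
  for M :: "'b measure" and N :: "'a measure" and X phi B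
begin

text \<open>The factor \<open>2 / (n sqrt v)\<close> gives the increments the variances
  \<open>4 j / n^2\<close>, which add up to \<open>2 (1 - 1 / n)\<close> and explain the exponent.
  As the weights lie in the unit interval, sums of their fourth powers are at most \<open>v\<close>,
  which controls the fluctuation of the conditional variances.\<close>

lemma char_kern_sum_approx:
  fixes a :: "nat \<Rightarrow> real" and n :: nat and t :: real
  assumes n: "n > 0" and a: "summable a" "\<And>k. 0 \<le> a k" "\<And>k. a k \<le> 1" and v_pos: "(\<Sum>k. (a k)\<^sup>2) > 0"
  defines "v \<equiv> (\<Sum>k. (a k)\<^sup>2)" and "S \<equiv> (\<Sum>k. a k)" and "b \<equiv> B\<^sup>2"
  shows "cmod ((CLINT \<omega>|M. iexp (t * (2 / (real n * sqrt v) * (\<Sum>j<n. \<Sum>i<j. N.kern a (X i \<omega>) (X j \<omega>)))))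
      - of_real (exp (- (t\<^sup>2 * (1 - 1 / real n)))))
    \<le> (\<bar>t\<bar> ^ 3 / 12 * (4 + 48 * b\<^sup>2 + 16 * b ^ 3) + t\<^sup>2 / 4 * (1 + 128 * b + 32 * b\<^sup>2))
        * sqrt (1 / real n + S\<^sup>2 / ((real n)\<^sup>2 * v) + 1 / v) + 2 * t ^ 4 / real n"
proof -
  define r where "r = 2 / (real n * sqrt v)"
  have r0: "r \<ge> 0" using v_pos by (auto simp: r_def v_def)
  have b0: "b \<ge> 0" by (simp add: b_def)
  have a_abs: "summable (\<lambda>k. \<bar>a k\<bar>)" using a by simp
  have a2_le: "(a k)\<^sup>2 \<le> a k" and a4_le: "((a k)\<^sup>2)\<^sup>2 \<le> (a k)\<^sup>2" for k
    using a by (auto simp: power2_eq_square mult_left_le mult_le_one)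
  have a2: "summable (\<lambda>k. (a k)\<^sup>2)"
    by (rule summable_comparison_test'[OF a(1), of 0]) (use a2_le in auto)
  have a4: "summable (\<lambda>k. ((a k)\<^sup>2)\<^sup>2)"
    by (rule summable_comparison_test'[OF a2, of 0]) (use a4_le in auto)
  have a2_abs: "summable (\<lambda>k. \<bar>(a k)\<^sup>2\<bar>)" and a4_abs: "summable (\<lambda>k. \<bar>((a k)\<^sup>2)\<^sup>2\<bar>)" using a2 a4 by simp_all
  \<comment> \<open>The first parameter is the trace of the squared kernel, the next two are sup
    bounds from \<open>B^2\<close> times coefficient sums, and the last comes from
    \<open>kern_square\<close> applied to the squared kernel itself.\<close>
  interpret degenerate_kernel M N X "\<lambda>x y. r * N.kern a x y" "\<lambda>x y. r\<^sup>2 * N.kern (\<lambda>k. (a k)\<^sup>2) x y"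
    "r\<^sup>2 * v" "r\<^sup>2 * (b * v)" "r * (b * S)" "r ^ 4 * (b * v)"
  proof
    show "bdd_measurable (N \<Otimes>\<^sub>M N) (\<lambda>(x, y). r * N.kern a x y)"
      "bdd_measurable (N \<Otimes>\<^sub>M N) (\<lambda>(x, y). r\<^sup>2 * N.kern (\<lambda>k. (a k)\<^sup>2) x y)"
      using bdd_measurable_mult[OF bdd_measurable_const N.kern_bdd[OF a_abs]]
        bdd_measurable_mult[OF bdd_measurable_const N.kern_bdd[OF a2_abs]]
      by (simp_all add: case_prod_beta')
  next
    fix x y assume xy: "x \<in> space N" "y \<in> space N"
    show "\<bar>r * N.kern a x y\<bar> \<le> r * (b * S)"
      using N.kern_le[OF a_abs xy] a r0 by (simp add: abs_mult b_def S_def mult_left_mono)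
    show "\<bar>r\<^sup>2 * N.kern (\<lambda>k. (a k)\<^sup>2) x y\<bar> \<le> r\<^sup>2 * (b * v)"
      using N.kern_le[OF a2_abs xy] by (simp add: abs_mult b_def v_def mult_left_mono)
    show "N.expectation (\<lambda>z. r * N.kern a z x * (r * N.kern a z y)) = r\<^sup>2 * N.kern (\<lambda>k. (a k)\<^sup>2) x y"
    proof -
      have "(\<lambda>z. r * N.kern a z x * (r * N.kern a z y)) = (\<lambda>z. r\<^sup>2 * (N.kern a z x * N.kern a z y))"
        by (auto simp: power2_eq_square)
      then show ?thesis by (simp add: N.kern_square[OF a_abs xy])
    qed
  next
    fix y assume y: "y \<in> space N"
    show "N.expectation (\<lambda>x. r * N.kern a x y) = 0" using N.kern_mean[OF a_abs y] by simp
    show "N.expectation (\<lambda>x. r\<^sup>2 * N.kern (\<lambda>k. (a k)\<^sup>2) x y) = 0" using N.kern_mean[OF a2_abs y] by simp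
    have "N.expectation (\<lambda>x. (r\<^sup>2 * N.kern (\<lambda>k. (a k)\<^sup>2) x y)\<^sup>2)
        = r ^ 4 * N.kern (\<lambda>k. ((a k)\<^sup>2)\<^sup>2) y y"
    proof -
      have "(\<lambda>x. (r\<^sup>2 * N.kern (\<lambda>k. (a k)\<^sup>2) x y)\<^sup>2)
        = (\<lambda>x. r ^ 4 * (N.kern (\<lambda>k. (a k)\<^sup>2) x y * N.kern (\<lambda>k. (a k)\<^sup>2) x y))"
        by (auto simp: power2_eq_square power4_eq_xxxx)
      then show ?thesis by (simp add: N.kern_square[OF a2_abs y y])
    qed
    also have "\<dots> \<le> r ^ 4 * (b * (\<Sum>k. ((a k)\<^sup>2)\<^sup>2))"
      using N.kern_le[OF a4_abs y y] by (intro mult_left_mono) (auto simp: b_def)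
    also have "\<dots> \<le> r ^ 4 * (b * v)"
      unfolding v_def using a4_le by (intro mult_left_mono suminf_le a2 a4 b0) auto
    finally show "N.expectation (\<lambda>x. (r\<^sup>2 * N.kern (\<lambda>k. (a k)\<^sup>2) x y)\<^sup>2) \<le> r ^ 4 * (b * v)" .
  next
    show "N.expectation (\<lambda>x. r\<^sup>2 * N.kern (\<lambda>k. (a k)\<^sup>2) x x) = r\<^sup>2 * v"
      by (simp add: N.kern_diag_mean[OF a2_abs] v_def)
  qed (simp_all add: N.kern_sym)
  let ?d = "sqrt (1 / real n + S\<^sup>2 / ((real n)\<^sup>2 * v) + 1 / v)"
  have v: "v > 0" using v_pos by (simp add: v_def)
  have S: "S \<ge> 0" unfolding S_def by (intro suminf_nonneg a)
  have d: "?d > 0" using n v by (auto intro!: add_pos_nonneg)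
  have "cmod ((CLINT \<omega>|M. iexp (t * U n \<omega>)) - of_real (exp (- (t\<^sup>2 * (r\<^sup>2 * v) * (real n * (real n - 1)) / 4))))
     \<le> (\<bar>t\<bar> ^ 3 / 12 * (4 + 48 * b\<^sup>2 + 16 * b ^ 3) + t\<^sup>2 / 4 * (1 + 128 * b + 32 * b\<^sup>2)) * ?d + 2 * t ^ 4 / real n"
    using char_U_approx[OF d, of "?d / real n" t n] error_bound_rescaled[of "real n" v S b t] n v S b0 d
    unfolding r_def[symmetric] by simp
  also have "t\<^sup>2 * (r\<^sup>2 * v) * (real n * (real n - 1)) / 4 = t\<^sup>2 * (1 - 1 / real n)"
    unfolding r_def power_divide power_mult_distrib using n v by (simp add: field_simps power2_eq_square)
  finally show ?thesis
    unfolding U_def sum_distrib_left[symmetric] by (simp only: r_def)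
qed

end

subsection \<open>Eigenvalue asymptotics\<close>

text \<open>Integral comparison in telescoping form: by the mean value theorem the right-hand side
  is \<open>z powr (- p)\<close> for some \<open>z\<close> below \<open>k + 1\<close>.\<close>

lemma inverse_powr_le_diff:
  fixes k p :: real
  assumes "k > 0" "p > 1"
  shows "(k + 1) powr (- p) \<le> (k powr (1 - p) - (k + 1) powr (1 - p)) / (p - 1)"
proof -
  have "\<exists>z>k. z < k + 1 \<and> (k + 1) powr (1 - p) - k powr (1 - p) = (k + 1 - k) * ((1 - p) * z powr (- p))"
    using assms by (intro MVT2) (auto intro!: derivative_eq_intros)
  then obtain z where z: "k < z" "z < k + 1" "(k + 1) powr (1 - p) - k powr (1 - p) = (1 - p) * z powr (- p)"
    by auto
  have "(k + 1) powr (- p) \<le> z powr (- p)"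
    using z assms by (intro powr_mono2') auto
  also have "z powr (- p) = (k powr (1 - p) - (k + 1) powr (1 - p)) / (p - 1)"
    using z(3) assms by (simp add: field_simps)
  finally show ?thesis .
qed

text \<open>Two-sided bounds at every index instead of asymptotic ones; \<open>Suc k\<close> is the
  one-based index of the eigenvalue.\<close>

locale polynomial_decay =
  fixes lam :: "nat \<Rightarrow> real" and s c C :: real
  assumes s: "s > 1/2" and lam_pos: "\<And>k. lam k > 0" and c: "c > 0"
    and lam_ge: "\<And>k. c \<le> real (Suc k) powr (2 * s) * lam k"
    and lam_le: "\<And>k. real (Suc k) powr (2 * s) * lam k \<le> C"
begin

lemma shrink_pos: "r > 0 \<Longrightarrow> 0 < shrink lam r k"
  using lam_pos[of k] by (simp add: shrink_def add_pos_nonneg)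

lemma shrink_le_1: "r > 0 \<Longrightarrow> shrink lam r k \<le> 1"
  using lam_pos[of k] by (simp add: shrink_def add_pos_nonneg)

lemma C_pos: "C > 0"
  using c lam_ge[of 0] lam_le[of 0] by linarith

lemma shrink_le:
  assumes "r > 0"
  shows "shrink lam r k \<le> C / r\<^sup>2 * real (Suc k) powr (- (2 * s))"
proof -
  have "shrink lam r k \<le> lam k / r\<^sup>2"
    unfolding shrink_def using lam_pos[of k] assms by (intro divide_left_mono) (auto intro!: mult_pos_pos add_pos_pos)
  also have "lam k \<le> C * real (Suc k) powr (- (2 * s))"
    using lam_le[of k] by (simp add: powr_minus field_simps)
  finally show ?thesis using assms by (simp add: divide_right_mono)
qed

lemma shrink_summable:
  assumes "r > 0"
  shows "summable (shrink lam r)"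
proof (rule summable_comparison_test'[where N = 0])
  have "summable (\<lambda>k. real k powr (- (2 * s)))"
    using s by (subst summable_real_powr_iff) auto
  then have "summable (\<lambda>k. real (Suc k) powr (- (2 * s)))"
    by (subst summable_Suc_iff)
  then show "summable (\<lambda>k. C / r\<^sup>2 * real (Suc k) powr (- (2 * s)))"
    by (rule summable_mult)
  show "norm (shrink lam r k) \<le> C / r\<^sup>2 * real (Suc k) powr (- (2 * s))" for k
    using shrink_le[OF assms, of k] shrink_pos[OF assms, of k] by simp
qed

text \<open>The sum is cut at \<open>k \<approx> r\<^bsup>-1/s\<^esup>\<close>, where the eigenvalue is of order \<open>r\<^sup>2\<close>.\<close>

lemma shrink_suminf_le:
  assumes r: "0 < r" "r \<le> 1"
  shows "(\<Sum>k. shrink lam r k) \<le> (2 + C / (2 * s - 1)) * r powr (- 1 / s)"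
proof -
  define y where "y = r powr (- 1 / s)"
  define N where "N = nat \<lceil>y\<rceil>"
  \<comment> \<open>This is where \<open>r \<le> 1\<close> enters: for \<open>y \<ge> 1\<close>
    rounding up at most doubles \<open>y\<close>.\<close>
  have y1: "y \<ge> 1"
    using powr_mono'[of "- 1 / s" 0 r] r s by (simp add: y_def)
  have N: "y \<le> real N" "real N \<le> 2 * y" "N > 0"
    using y1 by (auto simp: N_def) linarith+
  let ?D = "C / r\<^sup>2 / (2 * s - 1)"
  let ?f = "\<lambda>m. real m powr (1 - 2 * s)"
  have D: "?D \<ge> 0" using s C_pos by auto
  have low: "(\<Sum>k<m. shrink lam r k) \<le> real m" for m
    using sum_mono[of "{..<m}" "shrink lam r" "\<lambda>_. 1"] shrink_le_1[OF r(1)] by simp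
  \<comment> \<open>Up to the cut each weight is bounded by one; beyond it the bounds telescope by
    \<open>inverse_powr_le_diff\<close>.\<close>
  have high: "(\<Sum>k<m. shrink lam r k) \<le> real N + ?D * (?f N - ?f m)" if "m \<ge> N" for m
    using that
  proof (induction m rule: nat_induct_at_least)
    case base
    then show ?case using low[of N] by simp
  next
    case (Suc m)
    have "shrink lam r m \<le> C / r\<^sup>2 * real (Suc m) powr (- (2 * s))"
      by (rule shrink_le[OF r(1)])
    also have "\<dots> \<le> C / r\<^sup>2 * ((?f m - ?f (Suc m)) / (2 * s - 1))"
      using inverse_powr_le_diff[of "real m" "2 * s"] s Suc N C_pos
      by (intro mult_left_mono) (auto simp: add.commute)
    finally show ?case using Suc by (simp add: algebra_simps diff_divide_distrib)
  qed
  have "(\<Sum>k<m. shrink lam r k) \<le> real N + ?D * ?f N" for m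
  proof (cases "m \<ge> N")
    case True
    have "?D * (?f N - ?f m) \<le> ?D * ?f N" by (intro mult_left_mono D) auto
    with high[OF True] show ?thesis by linarith
  next
    case False
    then show ?thesis using low[of m] D mult_nonneg_nonneg[OF D, of "?f N"] by auto
  qed
  then have "(\<Sum>k. shrink lam r k) \<le> real N + ?D * ?f N"
    by (intro suminf_le_const shrink_summable r)
  also have "\<dots> \<le> 2 * y + ?D * y powr (1 - 2 * s)"
    using N y1 s by (intro add_mono mult_left_mono D powr_mono2') auto
  \<comment> \<open>At the cut the tail bound is of the same order \<open>y\<close> as the head,
    which is what determines the choice of \<open>y\<close>.\<close>
  also have "y powr (1 - 2 * s) = r\<^sup>2 * y"
  proof -
    have "y powr (1 - 2 * s) = r powr (2 + - 1 / s)"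
    proof -
      have "- 1 / s * (1 - 2 * s) = 2 + - 1 / s" using s by (simp add: field_simps)
      then show ?thesis unfolding y_def powr_powr by simp
    qed
    also have "\<dots> = r\<^sup>2 * y"
      unfolding powr_add y_def using r by simp
    finally show ?thesis .
  qed
  also have "2 * y + ?D * (r\<^sup>2 * y) = (2 + C / (2 * s - 1)) * y"
  proof -
    have "?D * (r\<^sup>2 * y) = C / (2 * s - 1) * y" using r by simp
    then show ?thesis by (simp add: distrib_right)
  qed
  finally show ?thesis by (simp add: y_def)
qed

lemma shrink_square_summable:
  assumes "r > 0"
  shows "summable (\<lambda>k. (shrink lam r k)\<^sup>2)"
  by (rule summable_comparison_test'[OF shrink_summable[OF assms], of 0])
    (use shrink_pos[OF assms] shrink_le_1[OF assms] in \<open>auto simp: power2_eq_square less_imp_le intro!: mult_left_le\<close>)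

text \<open>Eigenvalues up to the index \<open>y = (c / r^2) powr (1 / (2 s))\<close> are at least
  \<open>r^2\<close>, so their weights are at least 1/2 and the squares at least 1/4. Rounding
  \<open>y\<close> down costs another factor 2, hence the 8; \<open>r^2 \<le> c\<close> guarantees
  \<open>y \<ge> 1\<close>.\<close>

lemma vn_ge:
  assumes r: "0 < r" "r\<^sup>2 \<le> c"
  shows "c powr (1 / (2 * s)) / 8 * r powr (- 1 / s) \<le> vn lam r"
proof -
  define y where "y = (c / r\<^sup>2) powr (1 / (2 * s))"
  define N where "N = nat \<lfloor>y\<rfloor>"
  have y1: "y \<ge> 1" unfolding y_def using r s by (intro ge_one_powr_ge_zero) auto
  have N: "real N \<ge> y / 2" "real N \<le> y"
  proof -
    have "\<lfloor>y\<rfloor> \<ge> 1" using y1 by simp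
    then have "real N = of_int \<lfloor>y\<rfloor>" "real N \<ge> 1" by (auto simp: N_def)
    moreover have "of_int \<lfloor>y\<rfloor> \<le> y" "y < of_int \<lfloor>y\<rfloor> + 1" by linarith+
    ultimately show "real N \<ge> y / 2" "real N \<le> y" by linarith+
  qed
  have y_eq: "y = c powr (1 / (2 * s)) * r powr (- 1 / s)"
  proof -
    have "r\<^sup>2 = r powr 2" using r by simp
    then have "(r\<^sup>2) powr (1 / (2 * s)) = r powr (1 / s)"
      by (simp only: powr_powr) simp
    then show ?thesis
      unfolding y_def using r c by (simp add: powr_divide powr_minus_divide)
  qed
  have "1 / 4 \<le> (shrink lam r k)\<^sup>2" if "k < N" for k
  proof -
    have "real (Suc k) \<le> y" using that N by linarith
    then have "real (Suc k) powr (2 * s) \<le> y powr (2 * s)" using s by (intro powr_mono2) auto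
    also have "\<dots> = c / r\<^sup>2" unfolding y_def powr_powr using s r c by simp
    finally have "r\<^sup>2 * real (Suc k) powr (2 * s) \<le> c"
      using r by (simp add: field_simps)
    also note lam_ge[of k]
    finally have "r\<^sup>2 \<le> lam k" by (simp add: mult.commute)
    then have "1 / 2 \<le> shrink lam r k"
      unfolding shrink_def using lam_pos[of k] r by (simp add: field_simps add_pos_pos)
    then have "(1 / 2)\<^sup>2 \<le> (shrink lam r k)\<^sup>2" by (intro power_mono) auto
    then show ?thesis by (simp add: power2_eq_square)
  qed
  then have "real N * (1 / 4) \<le> (\<Sum>k<N. (shrink lam r k)\<^sup>2)"
    using sum_mono[of "{..<N}" "\<lambda>_. 1 / 4" "\<lambda>k. (shrink lam r k)\<^sup>2"] by simp
  also have "\<dots> \<le> vn lam r"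
    unfolding vn_def by (intro sum_le_suminf shrink_square_summable r) auto
  finally show ?thesis using N y_eq by simp
qed

lemma vn_pos:
  assumes "r > 0"
  shows "vn lam r > 0"
  unfolding vn_def using shrink_pos[OF assms]
  by (intro suminf_pos shrink_square_summable assms zero_less_power)

text \<open>The upper bound on the sum of weights and the lower bound on \<open>vn\<close> have the
  same order \<open>rho n powr (- 1 / s)\<close>. Thus the last term vanishes because
  \<open>rho\<close> does, and the middle one is of the order of the inverse square of the quantity
  in \<open>rate\<close>.\<close>

lemma error_tendsto_0:
  assumes rho_pos: "\<And>n. rho n > 0" and rho_lim: "rho \<longlonglongrightarrow> 0"
    and rate: "filterlim (\<lambda>n. real n * rho n powr (1 / (2 * s))) at_top sequentially"
  shows "(\<lambda>n. 1 / real n + (\<Sum>k. shrink lam (rho n) k)\<^sup>2 / ((real n)\<^sup>2 * vn lam (rho n)) + 1 / vn lam (rho n))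
    \<longlonglongrightarrow> 0"
proof -
  define c' where "c' = c powr (1 / (2 * s)) / 8"
  define C' where "C' = 2 + C / (2 * s - 1)"
  have c': "c' > 0" using c by (simp add: c'_def)
  have small: "\<forall>\<^sub>F n in sequentially. rho n \<le> 1 \<and> (rho n)\<^sup>2 \<le> c \<and> n > 0"
  proof -
    have "\<forall>\<^sub>F n in sequentially. rho n < min 1 (sqrt c)"
      using c by (intro order_tendstoD(2)[OF rho_lim]) auto
    with eventually_gt_at_top[of 0] show ?thesis
    proof eventually_elim
      case (elim n)
      then have "(rho n)\<^sup>2 \<le> (sqrt c)\<^sup>2" using rho_pos[of n] by (intro power_mono) auto
      then show ?case using elim c by auto
    qed
  qed
  have v0: "(\<lambda>n. 1 / vn lam (rho n)) \<longlonglongrightarrow> 0"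
  proof (rule real_tendsto_sandwich)
    show "\<forall>\<^sub>F n in sequentially. 0 \<le> 1 / vn lam (rho n)"
      using vn_pos[OF rho_pos] by (auto simp: less_imp_le)
    show "\<forall>\<^sub>F n in sequentially. 1 / vn lam (rho n) \<le> 1 / c' * rho n powr (1 / s)"
      using small
    proof eventually_elim
      case (elim n)
      have "1 / vn lam (rho n) \<le> 1 / (c' * rho n powr (- 1 / s))"
        using vn_ge[of "rho n"] elim rho_pos[of n] c' vn_pos[OF rho_pos[of n]]
        by (intro divide_left_mono) (auto simp: c'_def)
      then show ?case by (simp add: powr_minus divide_inverse mult_ac)
    qed
    have "(\<lambda>n. rho n powr (1 / s)) \<longlonglongrightarrow> 0"
      using tendsto_powr2[OF rho_lim tendsto_const, of "1 / s"] rho_pos s by (simp add: less_imp_le)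
    then show "(\<lambda>n. 1 / c' * rho n powr (1 / s)) \<longlonglongrightarrow> 0" by (rule tendsto_mult_right_zero)
  qed simp
  have S0: "(\<lambda>n. (\<Sum>k. shrink lam (rho n) k)\<^sup>2 / ((real n)\<^sup>2 * vn lam (rho n))) \<longlonglongrightarrow> 0"
  proof (rule real_tendsto_sandwich)
    show "\<forall>\<^sub>F n in sequentially. 0 \<le> (\<Sum>k. shrink lam (rho n) k)\<^sup>2 / ((real n)\<^sup>2 * vn lam (rho n))"
      using vn_pos[OF rho_pos] by (auto simp: less_imp_le)
    show "\<forall>\<^sub>F n in sequentially. (\<Sum>k. shrink lam (rho n) k)\<^sup>2 / ((real n)\<^sup>2 * vn lam (rho n))
        \<le> C'\<^sup>2 / c' * (inverse (real n * rho n powr (1 / (2 * s))))\<^sup>2"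
      using small
    proof eventually_elim
      case (elim n)
      define z where "z = rho n powr (- 1 / s)"
      have z: "z > 0" "(rho n powr (1 / (2 * s)))\<^sup>2 = inverse z"
        using rho_pos[of n] by (auto simp: z_def powr_powr simp flip: powr_numeral powr_minus)
      have "0 \<le> (\<Sum>k. shrink lam (rho n) k)"
        using shrink_pos[OF rho_pos] by (intro suminf_nonneg shrink_summable rho_pos) (auto simp: less_imp_le)
      then have "(\<Sum>k. shrink lam (rho n) k)\<^sup>2 \<le> (C' * z)\<^sup>2"
        using shrink_suminf_le[of "rho n"] elim rho_pos[of n] by (intro power_mono) (auto simp: C'_def z_def)
      moreover have "(real n)\<^sup>2 * (c' * z) \<le> (real n)\<^sup>2 * vn lam (rho n)"
        using vn_ge[of "rho n"] elim rho_pos[of n] by (intro mult_left_mono) (auto simp: c'_def z_def)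
      ultimately have "(\<Sum>k. shrink lam (rho n) k)\<^sup>2 / ((real n)\<^sup>2 * vn lam (rho n)) \<le> (C' * z)\<^sup>2 / ((real n)\<^sup>2 * (c' * z))"
        using elim c' z by (intro frac_le) auto
      \<comment> \<open>The ratio is a constant times \<open>z / n^2\<close>, and \<open>z\<close>
        is the inverse square of \<open>rho n powr (1 / (2 s))\<close>.\<close>
      also have "\<dots> = C'\<^sup>2 / c' * (inverse (real n * rho n powr (1 / (2 * s))))\<^sup>2"
        unfolding power_inverse power_mult_distrib z(2) using elim c' z
        by (simp add: field_simps power2_eq_square)
      finally show ?case .
    qed
    have "(\<lambda>n. inverse (real n * rho n powr (1 / (2 * s)))) \<longlonglongrightarrow> 0"
      by (rule tendsto_inverse_0_at_top[OF rate])
    from tendsto_power[OF this, of 2]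
    show "(\<lambda>n. C'\<^sup>2 / c' * (inverse (real n * rho n powr (1 / (2 * s))))\<^sup>2) \<longlonglongrightarrow> 0"
      by (intro tendsto_mult_right_zero) simp
  qed simp
  have "(\<lambda>n. 1 / real n) \<longlonglongrightarrow> 0" by (rule lim_1_over_n)
  from tendsto_add[OF tendsto_add[OF this S0] v0] show ?thesis by simp
qed

end

text \<open>The limits give bounds from some index on; the finitely many earlier values are
  positive, so a minimum and a maximum extend the bounds to all indices.\<close>

lemma polynomial_decay_of_limits:
  assumes s: "s > 1/2" and lam_pos: "\<And>k. lam k > 0"
    and lim_inf: "Liminf sequentially (\<lambda>k. ereal (real (Suc k) powr (2 * s) * lam k)) > 0"
    and lim_sup: "Limsup sequentially (\<lambda>k. ereal (real (Suc k) powr (2 * s) * lam k)) < \<infinity>"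
  obtains c C where "polynomial_decay lam s c C"
proof -
  let ?f = "\<lambda>k. real (Suc k) powr (2 * s) * lam k"
  have f_pos: "?f k > 0" for k using lam_pos[of k] by simp
  obtain c0 where c0: "0 < ereal c0" "ereal c0 < Liminf sequentially (\<lambda>k. ereal (?f k))"
    using ereal_dense2[OF lim_inf] by blast
  from less_LiminfD[OF c0(2)] obtain K where K: "\<And>k. k \<ge> K \<Longrightarrow> c0 < ?f k"
    by (auto simp: eventually_sequentially)
  have lo: "Min (insert c0 (?f ` {..<K})) \<le> ?f k" for k
  proof (cases "k < K")
    case False
    then have "Min (insert c0 (?f ` {..<K})) \<le> c0" by (intro Min_le) auto
    also have "c0 \<le> ?f k" using K[of k] False by simp
    finally show ?thesis .
  qed (intro Min_le, auto)
  obtain C0 where C0: "Limsup sequentially (\<lambda>k. ereal (?f k)) < ereal C0"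
    using ereal_dense2[OF lim_sup] by blast
  from Limsup_lessD[OF C0] obtain L where L: "\<And>k. k \<ge> L \<Longrightarrow> ?f k < C0"
    by (auto simp: eventually_sequentially)
  have hi: "?f k \<le> Max (insert C0 (?f ` {..<L}))" for k
  proof (cases "k < L")
    case False
    then have "?f k \<le> C0" using L[of k] by simp
    also have "C0 \<le> Max (insert C0 (?f ` {..<L}))" by (intro Max_ge) auto
    finally show ?thesis .
  qed (intro Max_ge, auto)
  have "Min (insert c0 (?f ` {..<K})) > 0"
    using c0 f_pos by (subst Min_gr_iff) auto
  with s lam_pos lo hi show ?thesis
    by (intro that polynomial_decay.intro)
qed

subsection \<open>Asymptotic normality\<close>

lemma sum_symmetric_square:
  fixes h :: "'a \<Rightarrow> 'a \<Rightarrow> real" and x :: "nat \<Rightarrow> 'a"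
  assumes "\<And>x y. h x y = h y x"
  shows "(\<Sum>i<n. \<Sum>j<n. h (x i) (x j)) = (\<Sum>i<n. h (x i) (x i)) + 2 * (\<Sum>j<n. \<Sum>i<j. h (x i) (x j))"
proof (induction n)
  case (Suc n)
  have "(\<Sum>i<Suc n. \<Sum>j<Suc n. h (x i) (x j))
      = (\<Sum>i<n. \<Sum>j<n. h (x i) (x j)) + (\<Sum>i<n. h (x i) (x n)) + (\<Sum>j<n. h (x n) (x j)) + h (x n) (x n)"
    by (simp add: sum.distrib)
  also have "(\<Sum>j<n. h (x n) (x j)) = (\<Sum>i<n. h (x i) (x n))"
    by (simp add: assms[of "x n"])
  finally show ?case using Suc by simp
qed simp

section \<open>The centred statistic as a degenerate U-statistic\<close>

context bounded_orthonormal
begin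

lemma Ktilde_eq_kern: "Ktilde lam phi r = kern (shrink lam r)"
  unfolding Ktilde_def kern_def by auto

text \<open>Expanding the squares turns \<open>eta2\<close> into a double sum of kernel values.
  \<open>An\<close> is exactly its diagonal, so centring leaves twice the sum over pairs.\<close>

lemma centered_eta2_eq:
  assumes n: "n > 0" and a: "summable (shrink lam r)" "\<And>k. 0 \<le> shrink lam r k"
    and x: "\<And>i. x i \<in> space N"
  shows "real n * eta2 lam phi r n x - An lam phi r n x
    = 2 / real n * (\<Sum>j<n. \<Sum>i<j. kern (shrink lam r) (x i) (x j))"
proof -
  let ?a = "shrink lam r"
  have a_abs: "summable (\<lambda>k. \<bar>?a k\<bar>)" using a by simp
  have sm: "summable (\<lambda>k. ?a k * phi k (x i) * phi k (x j))" for i j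
    by (rule summable_rabs_cancel[OF kern_summable[OF a_abs x x]])
  have "eta2 lam phi r n x = (\<Sum>k. (1 / (real n)\<^sup>2) * (\<Sum>i<n. \<Sum>j<n. ?a k * phi k (x i) * phi k (x j)))"
    unfolding eta2_def
    by (simp add: power2_eq_square sum_product sum_distrib_left mult_ac)
  also have "\<dots> = (1 / (real n)\<^sup>2) * (\<Sum>k. \<Sum>i<n. \<Sum>j<n. ?a k * phi k (x i) * phi k (x j))"
    by (intro suminf_mult summable_sum sm)
  also have "(\<Sum>k. \<Sum>i<n. \<Sum>j<n. ?a k * phi k (x i) * phi k (x j)) = (\<Sum>i<n. \<Sum>j<n. kern ?a (x i) (x j))"
    unfolding kern_def by (simp add: suminf_sum summable_sum sm)
  finally have "real n * eta2 lam phi r n x = 1 / real n * (\<Sum>i<n. \<Sum>j<n. kern ?a (x i) (x j))"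
    using n by (simp add: power2_eq_square)
  then show ?thesis
    unfolding An_def Ktilde_eq_kern sum_symmetric_square[of "kern ?a", OF kern_sym]
    by (simp add: algebra_simps)
qed

end

text \<open>\<open>normal_density\<close> takes the standard deviation, so variance 2 appears as
  \<open>sqrt 2\<close>; the law is the image of the standard normal one under scaling.\<close>

lemma char_normal_density_sqrt2:
  "char (density lborel (normal_density 0 (sqrt 2))) t = of_real (exp (- t\<^sup>2))"
proof -
  interpret S: prob_space std_normal_distribution
    using prob_space_normal_density[of 1 0] by simp
  have "distributed std_normal_distribution lborel (\<lambda>x. x) std_normal_density"
    unfolding distributed_def by (auto simp: distr_id2)
  from S.normal_density_affine[OF this, of "sqrt 2" 0]
  have "distr std_normal_distribution lborel (\<lambda>x. sqrt 2 * x) = density lborel (normal_density 0 (sqrt 2))"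
    by (simp add: distributed_def)
  then have "char (density lborel (normal_density 0 (sqrt 2))) t
      = (CLINT x|distr std_normal_distribution lborel (\<lambda>x. sqrt 2 * x). iexp (t * x))"
    by (simp add: char_def)
  also have "\<dots> = (CLINT x|std_normal_distribution. iexp ((t * sqrt 2) * x))"
    by (subst integral_distr) (auto simp: mult_ac)
  also have "\<dots> = of_real (exp (- t\<^sup>2))"
    unfolding char_def[symmetric] char_std_normal_distribution by (simp add: power_mult_distrib)
  finally show ?thesis .
qed

theorem theorem2:
  fixes P0 :: "'a measure"
    and K :: "'a \<Rightarrow> 'a \<Rightarrow> real"
    and lam :: "nat \<Rightarrow> real"
    and phi :: "nat \<Rightarrow> 'a \<Rightarrow> real"
    and s :: real
    and rho :: "nat \<Rightarrow> real"
    and Pr :: "'b measure"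
    and X :: "nat \<Rightarrow> 'b \<Rightarrow> 'a"
  assumes P0: "prob_space P0"
    \<comment> \<open>phi is an orthonormal basis of the P0-mean-zero functions in L2(P0)\<close>
    and phi_meas: "\<And>k. phi k \<in> borel_measurable P0"
    and phi_sq_int: "\<And>k. integrable P0 (\<lambda>x. (phi k x)\<^sup>2)"
    and phi_mean0: "\<And>k. integral\<^sup>L P0 (phi k) = 0"
    and phi_orthonormal: "\<And>j k. integral\<^sup>L P0 (\<lambda>x. phi j x * phi k x) = (if j = k then 1 else 0)"
    and phi_complete: "\<And>f. f \<in> borel_measurable P0 \<Longrightarrow> integrable P0 (\<lambda>x. (f x)\<^sup>2) \<Longrightarrow>
         integral\<^sup>L P0 f = 0 \<Longrightarrow> (\<forall>k. integral\<^sup>L P0 (\<lambda>x. f x * phi k x) = 0) \<Longrightarrow>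
         (AE x in P0. f x = 0)"
    and phi_bdd: "\<exists>B. \<forall>k. \<forall>x\<in>space P0. \<bar>phi k x\<bar> \<le> B"
    \<comment> \<open>eigenvalues: positive, strictly decreasing, polynomial decay of order 2s\<close>
    and lam_pos: "\<And>k. lam k > 0"
    and lam_decr: "\<And>k. lam (Suc k) < lam k"
    and s_gt: "s > 1/2"
    and lam_liminf: "Liminf sequentially (\<lambda>k. ereal (real (Suc k) powr (2 * s) * lam k)) > 0"
    and lam_limsup: "Limsup sequentially (\<lambda>k. ereal (real (Suc k) powr (2 * s) * lam k)) < \<infinity>"
    \<comment> \<open>Mercer decomposition of the kernel\<close>
    and K_mercer: "\<And>x x'. x \<in> space P0 \<Longrightarrow> x' \<in> space P0 \<Longrightarrow>
         K x x' = (\<Sum>k. lam k * phi k x * phi k x')"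
    \<comment> \<open>regularization sequence\<close>
    and rho_pos: "\<And>n. rho n > 0"
    and rho_lim: "rho \<longlonglongrightarrow> 0"
    and rho_rate: "filterlim (\<lambda>n. real n * rho n powr (1 / (2 * s))) at_top sequentially"
    \<comment> \<open>X_1, X_2, ... i.i.d. from P0\<close>
    and Pr: "prob_space Pr"
    and X_meas: "\<And>i. X i \<in> measurable Pr P0"
    and X_distr: "\<And>i. distr Pr P0 (X i) = P0"
    and X_indep: "prob_space.indep_vars Pr (\<lambda>_. P0) X UNIV"
  shows "weak_conv_m
     (\<lambda>n. distr Pr borel (\<lambda>\<omega>.
        (real n * eta2 lam phi (rho n) n (\<lambda>i. X i \<omega>) - An lam phi (rho n) n (\<lambda>i. X i \<omega>))
        / sqrt (vn lam (rho n))))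
     (density lborel (normal_density 0 (sqrt 2)))"
proof -
  obtain B where B: "\<And>k x. x \<in> space P0 \<Longrightarrow> \<bar>phi k x\<bar> \<le> B" using phi_bdd by blast
  obtain c C where "polynomial_decay lam s c C"
    using polynomial_decay_of_limits[OF s_gt lam_pos lam_liminf lam_limsup] .
  then interpret polynomial_decay lam s c C .
  interpret P0: prob_space P0 by fact
  interpret Pr: prob_space Pr by fact
  interpret iid_bounded_orthonormal Pr P0 X phi B
    by unfold_locales (use X_meas X_distr X_indep phi_meas phi_mean0 phi_orthonormal B in auto)
  note [measurable] = X_meas phi_meas
  define T where "T n \<omega> = (real n * eta2 lam phi (rho n) n (\<lambda>i. X i \<omega>) - An lam phi (rho n) n (\<lambda>i. X i \<omega>))
        / sqrt (vn lam (rho n))" for n \<omega>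
  define S where "S n = (\<Sum>k. shrink lam (rho n) k)" for n
  have T_meas [measurable]: "T n \<in> borel_measurable Pr" for n
    unfolding T_def[abs_def] eta2_def An_def Ktilde_def by measurable
  have T_eq: "T n \<omega> = 2 / (real n * sqrt (vn lam (rho n)))
      * (\<Sum>j<n. \<Sum>i<j. N.kern (shrink lam (rho n)) (X i \<omega>) (X j \<omega>))"
    if "n > 0" "\<omega> \<in> space Pr" for n \<omega>
    unfolding T_def
    using that measurable_space[OF X_meas that(2)] shrink_pos[OF rho_pos]
    by (subst N.centered_eta2_eq) (auto simp: less_imp_le intro!: shrink_summable rho_pos)
  have "weak_conv_m (\<lambda>n. distr Pr borel (T n)) (density lborel (normal_density 0 (sqrt 2)))"
  proof (rule levy_continuity)
    show "real_distribution (distr Pr borel (T n))" for n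
      by (intro Pr.real_distribution_distr) measurable
    show "real_distribution (density lborel (normal_density 0 (sqrt 2)))"
      using prob_space_normal_density[of "sqrt 2" 0]
      by (simp add: real_distribution_def real_distribution_axioms_def)
    fix t
    define b where "b = B\<^sup>2"
    \<comment> \<open>\<open>A\<close> depends on \<open>t\<close> and \<open>B\<close> only, so the
      convergence of \<open>e\<close> suffices.\<close>
    define A where "A = \<bar>t\<bar> ^ 3 / 12 * (4 + 48 * b\<^sup>2 + 16 * b ^ 3) + t\<^sup>2 / 4 * (1 + 128 * b + 32 * b\<^sup>2)"
    define e where "e n = 1 / real n + (S n)\<^sup>2 / ((real n)\<^sup>2 * vn lam (rho n)) + 1 / vn lam (rho n)" for n
    have e0: "e \<longlonglongrightarrow> 0"
      unfolding e_def S_def by (rule error_tendsto_0[OF rho_pos rho_lim rho_rate])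
    have bound: "cmod (char (distr Pr borel (T n)) t - of_real (exp (- (t\<^sup>2 * (1 - 1 / real n)))))
        \<le> A * sqrt (e n) + 2 * t ^ 4 * (1 / real n)" if n: "n > 0" for n
    proof -
      have "char (distr Pr borel (T n)) t = (CLINT \<omega>|Pr. iexp (t * T n \<omega>))"
        unfolding char_def by (subst integral_distr) auto
      also have "\<dots> = (CLINT \<omega>|Pr. iexp (t * (2 / (real n * sqrt (vn lam (rho n)))
          * (\<Sum>j<n. \<Sum>i<j. N.kern (shrink lam (rho n)) (X i \<omega>) (X j \<omega>)))))"
        by (intro Bochner_Integration.integral_cong refl) (simp only: T_eq[OF n])
      finally show ?thesis
        using char_kern_sum_approx[OF n shrink_summable[OF rho_pos] less_imp_le[OF shrink_pos[OF rho_pos]]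
            shrink_le_1[OF rho_pos] vn_pos[OF rho_pos, unfolded vn_def], of t n]
        unfolding A_def b_def e_def S_def vn_def by simp
    qed
    have "(\<lambda>n. char (distr Pr borel (T n)) t - of_real (exp (- (t\<^sup>2 * (1 - 1 / real n))))) \<longlonglongrightarrow> 0"
    proof (rule Lim_null_comparison)
      show "\<forall>\<^sub>F n in sequentially. cmod (char (distr Pr borel (T n)) t - of_real (exp (- (t\<^sup>2 * (1 - 1 / real n)))))
        \<le> A * sqrt (e n) + 2 * t ^ 4 * (1 / real n)"
        using eventually_gt_at_top[of 0] by eventually_elim (rule bound)
      have "(\<lambda>n. A * sqrt (e n) + 2 * t ^ 4 * (1 / real n)) \<longlonglongrightarrow> A * sqrt 0 + 2 * t ^ 4 * 0"
        by (intro tendsto_intros e0 lim_1_over_n)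
      then show "(\<lambda>n. A * sqrt (e n) + 2 * t ^ 4 * (1 / real n)) \<longlonglongrightarrow> 0" by simp
    qed
    \<comment> \<open>At index \<open>n\<close> the comparison is with variance
      \<open>2 (1 - 1 / n)\<close>; it remains to let this tend to 2.\<close>
    moreover have "(\<lambda>n. complex_of_real (exp (- (t\<^sup>2 * (1 - 1 / real n))))) \<longlonglongrightarrow> of_real (exp (- (t\<^sup>2 * (1 - 0))))"
      by (intro tendsto_intros lim_1_over_n)
    ultimately have "(\<lambda>n. char (distr Pr borel (T n)) t - of_real (exp (- (t\<^sup>2 * (1 - 1 / real n))))
        + of_real (exp (- (t\<^sup>2 * (1 - 1 / real n))))) \<longlonglongrightarrow> 0 + of_real (exp (- (t\<^sup>2 * (1 - 0))))"
      by (rule tendsto_add)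
    then show "(\<lambda>n. char (distr Pr borel (T n)) t) \<longlonglongrightarrow> char (density lborel (normal_density 0 (sqrt 2))) t"
      by (simp add: char_normal_density_sqrt2)
  qed
  then show ?thesis unfolding T_def[abs_def] .
qed

end
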